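(* Let $d\in\mathbb{N}$, let $\xi$ be a random variable with values in $\mathbb{Z}^d$, let $A\subset\mathbb{Z}^d$ be a finite set, let $\eta^{(x)}$, $x\in A$, be random variables with values in $\mathbb{Z}^d$, and let $X=(X(n))_{n\in\mathbb{N}_0}$ be the standard random walk perturbed on the set $A$, that is, the Markov chain on $\mathbb{Z}^d$ with transition probabilities $\mathbb{P}\{X(n+1)=y\mid X(n)=x\}=\mathbb{P}\{\xi=y-x\}$ if $x\notin A$ and $\mathbb{P}\{X(n+1)=y\mid X(n)=x\}=\mathbb{P}\{\eta^{(x)}=y-x\}$ if $x\in A$. Assume that, for a sequence of positive numbers $(a_n)_{n\in\mathbb{N}}$ and a stochastic process $\mathcal{S}=(\mathcal{S}(t))_{t\ge0}$, $$\Big(\frac{S_\xi(\lfloor nt\rfloor)}{a_n}\Big)_{t\geq 0}\ \Rightarrow\ (\mathcal{S}(t))_{t\geq 0},\quad n\to\infty$$ in the $J_1$-topology on $D([0,\infty),\mathbb{R}^d)$, and that the perturbed random walk $X$ visits $A$ finitely often with probability $1$. Then $$\Big(\frac{X(\lfloor nt\rfloor)}{a_n}\Big)_{t\geq 0}\ \Rightarrow\ (\mathcal{S}(t))_{t\geq 0},\quad n\to\infty$$ in the $J_1$-topology on $D([0,\infty),\mathbb{R}^d)$.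
   Context: $\mathbb{N}_0=\{0,1,2,\dots\}$. $\Rightarrow$ denotes weak convergence (convergence in distribution). $D([0,\infty),\mathbb{R}^d)$ is the Skorokhod space of càdlàg functions from $[0,\infty)$ to $\mathbb{R}^d$. Let $\xi_1,\xi_2,\ldots$ be independent copies of $\xi$; the standard random walk $S_\xi=(S_\xi(n))_{n\in\mathbb{N}_0}$ is defined by $S_\xi(0)=0$ (the zero vector) and $S_\xi(n)=\xi_1+\ldots+\xi_n$ for $n\in\mathbb{N}$.
   Formalization: Added assumption: if ξ = 0 almost surely, then a_n → ∞. Without it the claim fails, e.g. ξ = 0, A = {0}, η^(0) = e ≠ 0, X(0) = 0, a_n = 1; when ξ is not a.s. zero nothing is added. *)

theory Defs
  imports "HOL-Probability.Probability"
begin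

section \<open>The space \<open>D([0,\<infinity>), E)\<close> with the \<open>J\<^sub>1\<close>-topology\<close>

text \<open>
  A path on \<open>[0,\<infinity>)\<close> is a function on \<^typ>\<open>real\<close> that is \<^const>\<open>undefined\<close> off \<open>[0,\<infinity>)\<close>, so
  that two paths are equal as soon as they agree on \<open>[0,\<infinity>)\<close>.
\<close>

definition skorokhod_space :: "(real \<Rightarrow> 'a::topological_space) set" where
  "skorokhod_space = {x \<in> extensional {0..}.
     (\<forall>t\<ge>0. (x \<longlongrightarrow> x t) (at_right t)) \<and> (\<forall>t>0. \<exists>l. (x \<longlongrightarrow> l) (at_left t))}"

text \<open>Time changes: the increasing bijections of \<open>[0,\<infinity>)\<close>; they are homeomorphisms fixing 0.\<close>

definition time_changes :: "(real \<Rightarrow> real) set" where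
  "time_changes = {\<tau>. strict_mono_on {0..} \<tau> \<and> \<tau> ` {0..} = {0..}}"

definition J1_nbhd :: "(real \<Rightarrow> 'a::metric_space) \<Rightarrow> real \<Rightarrow> real \<Rightarrow> (real \<Rightarrow> 'a) set" where
  "J1_nbhd x T \<epsilon> = {y \<in> skorokhod_space. \<exists>\<tau>\<in>time_changes.
     (\<forall>t\<ge>0. \<bar>\<tau> t - t\<bar> < \<epsilon>) \<and> (\<forall>t\<in>{0..T}. dist (y (\<tau> t)) (x t) < \<epsilon>)}"

text \<open>
  The topology whose neighbourhood filter at \<open>x\<close> is generated by the sets \<open>J1_nbhd x T \<epsilon>\<close>.
  Lemma \<open>limitin_J1_topology\<close> below is the usual description of its convergent sequences:
  \<open>x\<^sub>n \<rightarrow> x\<close> iff there are time changes \<open>\<tau>\<^sub>n\<close> with \<open>\<tau>\<^sub>n \<rightarrow> id\<close> uniformly and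
  \<open>x\<^sub>n \<circ> \<tau>\<^sub>n \<rightarrow> x\<close> uniformly on each \<open>[0,T]\<close>.
\<close>

definition J1_topology :: "(real \<Rightarrow> 'a::metric_space) topology" where
  "J1_topology = topology (\<lambda>U. U \<subseteq> skorokhod_space \<and>
     (\<forall>x\<in>U. \<exists>T. \<exists>\<epsilon>>0. J1_nbhd x T \<epsilon> \<subseteq> U))"

lemma J1_nbhd_mono: "T \<le> T' \<Longrightarrow> \<epsilon>' \<le> \<epsilon> \<Longrightarrow> J1_nbhd x T' \<epsilon>' \<subseteq> J1_nbhd x T \<epsilon>"
  unfolding J1_nbhd_def by (auto intro!: bexI intro: less_le_trans)

lemma openin_J1_topology:
  "openin J1_topology U \<longleftrightarrow>
     U \<subseteq> skorokhod_space \<and> (\<forall>x\<in>U. \<exists>T. \<exists>\<epsilon>>0. J1_nbhd x T \<epsilon> \<subseteq> U)"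
proof -
  have "istopology (\<lambda>U. U \<subseteq> skorokhod_space \<and>
     (\<forall>x\<in>U. \<exists>T. \<exists>\<epsilon>>0. J1_nbhd (x :: real \<Rightarrow> 'a) T \<epsilon> \<subseteq> U))"
    unfolding istopology_def
  proof (intro conjI allI impI ballI)
    fix U V and x :: "real \<Rightarrow> 'a"
    assume U: "U \<subseteq> skorokhod_space \<and> (\<forall>x\<in>U. \<exists>T. \<exists>\<epsilon>>0. J1_nbhd x T \<epsilon> \<subseteq> U)"
      and V: "V \<subseteq> skorokhod_space \<and> (\<forall>x\<in>V. \<exists>T. \<exists>\<epsilon>>0. J1_nbhd x T \<epsilon> \<subseteq> V)"
      and x: "x \<in> U \<inter> V"
    obtain T \<epsilon> where 1: "\<epsilon> > 0" "J1_nbhd x T \<epsilon> \<subseteq> U" using U x by blast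
    obtain T' \<epsilon>' where 2: "\<epsilon>' > 0" "J1_nbhd x T' \<epsilon>' \<subseteq> V" using V x by blast
    have "J1_nbhd x (max T T') (min \<epsilon> \<epsilon>') \<subseteq> U \<inter> V"
      using J1_nbhd_mono[of T "max T T'" "min \<epsilon> \<epsilon>'" \<epsilon> x]
        J1_nbhd_mono[of T' "max T T'" "min \<epsilon> \<epsilon>'" \<epsilon>' x] 1 2 by auto
    then show "\<exists>T. \<exists>\<epsilon>>0. J1_nbhd x T \<epsilon> \<subseteq> U \<inter> V"
      using 1 2 by (metis min_less_iff_conj)
  next
    fix \<K> :: "(real \<Rightarrow> 'a) set set"
    assume K: "\<forall>U\<in>\<K>. U \<subseteq> skorokhod_space \<and> (\<forall>x\<in>U. \<exists>T. \<exists>\<epsilon>>0. J1_nbhd x T \<epsilon> \<subseteq> U)"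
    show "\<Union>\<K> \<subseteq> skorokhod_space" using K by blast
    fix x assume "x \<in> \<Union>\<K>"
    then obtain U where U: "U \<in> \<K>" "x \<in> U" by blast
    then obtain T \<epsilon> where "\<epsilon> > 0" "J1_nbhd x T \<epsilon> \<subseteq> U" using K by meson
    then show "\<exists>T. \<exists>\<epsilon>>0. J1_nbhd x T \<epsilon> \<subseteq> \<Union>\<K>" using U(1) by blast
  qed blast
  then show ?thesis
    unfolding J1_topology_def by (simp add: topology_inverse')
qed

lemma topspace_J1_topology: "topspace J1_topology = skorokhod_space"
proof
  show "topspace J1_topology \<subseteq> skorokhod_space"
    by (auto simp: topspace_def openin_J1_topology)
  have "openin J1_topology (skorokhod_space :: (real \<Rightarrow> 'a) set)"
    unfolding openin_J1_topology J1_nbhd_def using zero_less_one by blast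
  then show "(skorokhod_space :: (real \<Rightarrow> 'a) set) \<subseteq> topspace J1_topology"
    by (rule openin_subset)
qed

lemma id_time_changes: "(\<lambda>t. t) \<in> time_changes"
  by (auto simp: time_changes_def strict_mono_on_def)

lemma time_changes_comp:
  assumes "\<tau> \<in> time_changes" "\<mu> \<in> time_changes" shows "(\<lambda>t. \<mu> (\<tau> t)) \<in> time_changes"
proof -
  have "\<mu> ` \<tau> ` {0..} = {0..}" using assms by (simp add: time_changes_def)
  moreover have "\<tau> t \<ge> 0" if "t \<ge> 0" for t
    using assms that by (auto simp: time_changes_def)
  moreover have "strict_mono_on {0..} \<tau>" "strict_mono_on {0..} \<mu>"
    using assms by (auto simp: time_changes_def)
  ultimately show ?thesis
    unfolding time_changes_def strict_mono_on_def by (simp add: image_image)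
qed

lemma J1_nbhd_trans:
  assumes y: "y \<in> J1_nbhd x T \<delta>" and z: "z \<in> J1_nbhd y (T + \<delta>) \<delta>'"
  shows "z \<in> J1_nbhd x T (\<delta> + \<delta>')"
proof -
  obtain \<tau> where l: "\<tau> \<in> time_changes" "\<And>t. t \<ge> 0 \<Longrightarrow> \<bar>\<tau> t - t\<bar> < \<delta>"
      "\<And>t. t \<in> {0..T} \<Longrightarrow> dist (y (\<tau> t)) (x t) < \<delta>"
    using y by (auto simp: J1_nbhd_def)
  obtain \<mu> where m: "\<mu> \<in> time_changes" "\<And>t. t \<ge> 0 \<Longrightarrow> \<bar>\<mu> t - t\<bar> < \<delta>'"
      "\<And>t. t \<in> {0..T + \<delta>} \<Longrightarrow> dist (z (\<mu> t)) (y t) < \<delta>'"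
    using z by (auto simp: J1_nbhd_def)
  have nn: "\<tau> t \<ge> 0" if "t \<ge> 0" for t
    using l(1) that by (auto simp: time_changes_def)
  have 1: "\<bar>\<mu> (\<tau> t) - t\<bar> < \<delta> + \<delta>'" if "t \<ge> 0" for t
    using l(2)[OF that] m(2)[OF nn[OF that]] by linarith
  have 2: "dist (z (\<mu> (\<tau> t))) (x t) < \<delta> + \<delta>'" if "t \<in> {0..T}" for t
  proof -
    have "\<tau> t \<in> {0..T + \<delta>}" using l(2)[of t] nn[of t] that by auto
    from m(3)[OF this] l(3)[OF that] show ?thesis
      using dist_triangle[of "z (\<mu> (\<tau> t))" "x t" "y (\<tau> t)"] by linarith
  qed
  show ?thesis
    unfolding J1_nbhd_def
  proof (intro CollectI conjI bexI[of _ "\<lambda>t. \<mu> (\<tau> t)"])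
    show "z \<in> skorokhod_space" using z by (simp add: J1_nbhd_def)
  qed (use 1 2 time_changes_comp[OF l(1) m(1)] in auto)
qed

lemma self_in_J1_nbhd: "x \<in> skorokhod_space \<Longrightarrow> \<epsilon> > 0 \<Longrightarrow> x \<in> J1_nbhd x T \<epsilon>"
  unfolding J1_nbhd_def using id_time_changes by (auto intro!: bexI[of _ "\<lambda>t. t"])

lemma J1_nbhd_contains_open:
  fixes x :: "real \<Rightarrow> 'a::metric_space"
  assumes x: "x \<in> skorokhod_space" and e: "\<epsilon> > 0"
  shows "\<exists>U. openin J1_topology U \<and> x \<in> U \<and> U \<subseteq> J1_nbhd x T \<epsilon>"
proof (intro exI conjI)
  define U where "U = {y \<in> skorokhod_space. \<exists>S. \<exists>\<delta>>0. J1_nbhd y S \<delta> \<subseteq> J1_nbhd x T \<epsilon>}"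
  show "x \<in> U" using x e by (auto simp: U_def)
  show "U \<subseteq> J1_nbhd x T \<epsilon>" using self_in_J1_nbhd by (auto simp: U_def)
  show "openin J1_topology U"
    unfolding openin_J1_topology
  proof (intro conjI ballI)
    fix y assume "y \<in> U"
    then obtain S \<delta> where d: "\<delta> > 0" "J1_nbhd y S \<delta> \<subseteq> J1_nbhd x T \<epsilon>" by (auto simp: U_def)
    have "J1_nbhd y S (\<delta>/2) \<subseteq> U"
    proof
      fix z assume z: "z \<in> J1_nbhd y S (\<delta>/2)"
      have "J1_nbhd z (S + \<delta>/2) (\<delta>/2) \<subseteq> J1_nbhd y S \<delta>"
        using J1_nbhd_trans[OF z, of _ "\<delta>/2"] by auto
      then show "z \<in> U"
        using z d half_gt_zero[OF d(1)] unfolding U_def J1_nbhd_def[of y S "\<delta>/2"] by blast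
    qed
    then show "\<exists>T. \<exists>\<epsilon>>0. J1_nbhd y T \<epsilon> \<subseteq> U" using d(1) half_gt_zero by blast
  qed (auto simp: U_def)
qed

lemma limitin_J1_topology_nbhd:
  "limitin J1_topology f x F \<longleftrightarrow>
     x \<in> skorokhod_space \<and> (\<forall>T. \<forall>\<epsilon>>0. \<forall>\<^sub>F n in F. f n \<in> J1_nbhd x T \<epsilon>)"
  (is "?L \<longleftrightarrow> ?R")
proof
  assume L: ?L
  then have x: "x \<in> skorokhod_space" by (simp add: limitin_def topspace_J1_topology)
  moreover have "\<forall>\<^sub>F n in F. f n \<in> J1_nbhd x T \<epsilon>" if e: "\<epsilon> > 0" for T \<epsilon>
  proof -
    obtain U where U: "openin J1_topology U" "x \<in> U" "U \<subseteq> J1_nbhd x T \<epsilon>"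
      using J1_nbhd_contains_open[OF x e] by blast
    then have "\<forall>\<^sub>F n in F. f n \<in> U" using L by (simp add: limitin_def)
    then show ?thesis by (rule eventually_mono) (use U in auto)
  qed
  ultimately show ?R by blast
next
  assume R: ?R
  show ?L
    unfolding limitin_def
  proof (intro conjI allI impI)
    fix U assume "openin J1_topology U \<and> x \<in> U"
    then obtain T \<epsilon> where "\<epsilon> > 0" "J1_nbhd x T \<epsilon> \<subseteq> U" by (auto simp: openin_J1_topology)
    then show "\<forall>\<^sub>F n in F. f n \<in> U"
      using R eventually_mono[of "\<lambda>n. f n \<in> J1_nbhd x T \<epsilon>" F "\<lambda>n. f n \<in> U"] by blast
  qed (use R topspace_J1_topology in auto)
qed

lemma limitin_J1_topology:
  "limitin J1_topology f x sequentially \<longleftrightarrow>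
     x \<in> skorokhod_space \<and> (\<forall>\<^sub>F n in sequentially. f n \<in> skorokhod_space) \<and>
     (\<exists>\<tau>. (\<forall>n. \<tau> n \<in> time_changes) \<and>
       uniform_limit {0..} \<tau> (\<lambda>t. t) sequentially \<and>
       (\<forall>T. uniform_limit {0..T} (\<lambda>n t. f n (\<tau> n t)) x sequentially))"
  (is "?L \<longleftrightarrow> ?R")
proof
  assume ?L
  then have x: "x \<in> skorokhod_space"
    and ev: "\<And>T \<epsilon>. \<epsilon> > 0 \<Longrightarrow> \<forall>\<^sub>F n in sequentially. f n \<in> J1_nbhd x T \<epsilon>"
    by (auto simp: limitin_J1_topology_nbhd)
  define Q where "Q k n \<longleftrightarrow> k = 0 \<or> f n \<in> J1_nbhd x (real k) (1 / real k)" for k n :: nat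
  define K where "K n = (GREATEST k. k \<le> n \<and> Q k n)" for n
  have QK: "Q (K n) n" for n
    using GreatestI_nat[of "\<lambda>k. k \<le> n \<and> Q k n" 0 n] unfolding K_def by (auto simp: Q_def)
  have K_ge: "\<forall>\<^sub>F n in sequentially. k \<le> K n" for k
  proof -
    have "\<forall>\<^sub>F n in sequentially. Q k n"
      using ev[of "1 / real k" "real k"] by (cases "k = 0") (auto simp: Q_def)
    then show ?thesis
      using eventually_ge_at_top[of k]
    proof eventually_elim
      case (elim n)
      show ?case unfolding K_def by (rule Greatest_le_nat[of _ _ n]) (use elim in auto)
    qed
  qed
  have "\<exists>l\<in>time_changes. K n > 0 \<longrightarrow> (\<forall>t\<ge>0. \<bar>l t - t\<bar> < 1 / real (K n)) \<and>
      (\<forall>t\<in>{0..real (K n)}. dist (f n (l t)) (x t) < 1 / real (K n))" for n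
    using QK[of n] id_time_changes by (cases "K n = 0") (auto simp: Q_def J1_nbhd_def)
  then obtain l where l: "\<And>n. l n \<in> time_changes"
      "\<And>n t. K n > 0 \<Longrightarrow> t \<ge> 0 \<Longrightarrow> \<bar>l n t - t\<bar> < 1 / real (K n)"
      "\<And>n t. K n > 0 \<Longrightarrow> t \<in> {0..real (K n)} \<Longrightarrow> dist (f n (l n t)) (x t) < 1 / real (K n)"
    by metis
  have inv_le: "1 / real (K n) < e" if "e > 0" "K n > 0" "nat \<lceil>1 / e\<rceil> + 1 \<le> K n" for e n
  proof -
    have "1 / e < real (K n)" using that by linarith
    then show ?thesis using that by (simp add: field_simps)
  qed
  have "uniform_limit {0..} l (\<lambda>t. t) sequentially"
  proof (rule uniform_limitI)
    fix e :: real assume e: "e > 0"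
    show "\<forall>\<^sub>F n in sequentially. \<forall>t\<in>{0..}. dist (l n t) t < e"
      using K_ge[of "nat \<lceil>1 / e\<rceil> + 1"]
    proof eventually_elim
      case (elim n)
      then have "K n > 0" by simp
      then show ?case
        using l(2)[of n] inv_le[OF e _ elim] by (fastforce simp: dist_real_def)
    qed
  qed
  moreover have "uniform_limit {0..T} (\<lambda>n t. f n (l n t)) x sequentially" for T
  proof (rule uniform_limitI)
    fix e :: real assume e: "e > 0"
    show "\<forall>\<^sub>F n in sequentially. \<forall>t\<in>{0..T}. dist (f n (l n t)) (x t) < e"
      using K_ge[of "nat \<lceil>1 / e\<rceil> + 1"] K_ge[of "nat \<lceil>T\<rceil>"]
    proof eventually_elim
      case (elim n)
      then have K: "K n > 0" "T \<le> real (K n)" by linarith+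
      show ?case
        using l(3)[OF K(1)] inv_le[OF e K(1) elim(1)] K(2) by fastforce
    qed
  qed
  moreover have "\<forall>\<^sub>F n in sequentially. f n \<in> skorokhod_space"
    using ev[of 1 0] by (auto simp: J1_nbhd_def elim: eventually_mono)
  ultimately show ?R using x l(1) by blast
next
  assume R: ?R
  then obtain l where l: "\<And>n. l n \<in> time_changes"
      "uniform_limit {0..} l (\<lambda>t. t) sequentially"
      "\<And>T. uniform_limit {0..T} (\<lambda>n t. f n (l n t)) x sequentially" by auto
  have "\<forall>\<^sub>F n in sequentially. f n \<in> J1_nbhd x T \<epsilon>" if e: "\<epsilon> > 0" for T \<epsilon>
  proof -
    have "\<forall>\<^sub>F n in sequentially. f n \<in> skorokhod_space" using R by blast
    with uniform_limitD[OF l(2) e] uniform_limitD[OF l(3)[of T] e]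
    show ?thesis
    proof eventually_elim
      case (elim n)
      then show ?case
        unfolding J1_nbhd_def using l(1)[of n] by (auto simp: dist_real_def intro!: bexI[of _ "l n"])
    qed
  qed
  then show ?L using R by (simp add: limitin_J1_topology_nbhd)
qed


section \<open>Convergence in distribution in a topological space\<close>

definition borel_of :: "'b topology \<Rightarrow> 'b measure" where
  "borel_of T = sigma (topspace T) {U. openin T U}"

text \<open>
  Random elements \<open>Y n\<close>, defined on \<open>M n\<close>, converge in distribution to the random element \<open>Z\<close>,
  defined on \<open>N\<close>. Borel measurability of all of them is part of the notion, as otherwise the
  integrals would not be meaningful.
\<close>

definition converges_in_distribution ::
  "'b topology \<Rightarrow> (nat \<Rightarrow> 'w measure) \<Rightarrow> (nat \<Rightarrow> 'w \<Rightarrow> 'b) \<Rightarrow> 'v measure \<Rightarrow> ('v \<Rightarrow> 'b) \<Rightarrow> bool"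
  where
  "converges_in_distribution T M Y N Z \<longleftrightarrow>
     (\<forall>n. prob_space (M n) \<and> Y n \<in> M n \<rightarrow>\<^sub>M borel_of T) \<and>
     prob_space N \<and> Z \<in> N \<rightarrow>\<^sub>M borel_of T \<and>
     (\<forall>f. continuous_map T euclideanreal f \<and> bounded (f ` topspace T) \<longrightarrow>
        (\<lambda>n. \<integral>\<omega>. f (Y n \<omega>) \<partial>M n) \<longlonglongrightarrow> (\<integral>\<omega>. f (Z \<omega>) \<partial>N))"


section \<open>Random walks and perturbed random walks on the integer lattice\<close>

definition random_walk :: "(nat \<Rightarrow> 'w \<Rightarrow> int ^ 'd) \<Rightarrow> nat \<Rightarrow> 'w \<Rightarrow> int ^ 'd" where
  "random_walk \<xi> n \<omega> = (\<Sum>i=1..n. \<xi> i \<omega>)"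

definition vec_of_int :: "int ^ 'd \<Rightarrow> real ^ 'd" where
  "vec_of_int v = (\<chi> i. of_int (v $ i))"

text \<open>The path \<open>t \<mapsto> w(\<lfloor>nt\<rfloor>)/c\<close>.\<close>

definition scaled_path :: "(nat \<Rightarrow> int ^ 'd) \<Rightarrow> nat \<Rightarrow> real \<Rightarrow> real \<Rightarrow> real ^ 'd" where
  "scaled_path w n c = (\<lambda>t\<in>{0..}. vec_of_int (w (nat \<lfloor>real n * t\<rfloor>)) /\<^sub>R c)"

text \<open>A Markov chain with transition probabilities \<open>p\<close> and arbitrary initial distribution.\<close>

definition markov_chain :: "'w measure \<Rightarrow> ('s \<Rightarrow> 's \<Rightarrow> real) \<Rightarrow> (nat \<Rightarrow> 'w \<Rightarrow> 's) \<Rightarrow> bool" where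
  "markov_chain M p X \<longleftrightarrow>
     prob_space M \<and> (\<forall>n. X n \<in> M \<rightarrow>\<^sub>M count_space UNIV) \<and>
     (\<forall>n h y. \<P>(\<omega> in M. \<forall>k\<le>n. X k \<omega> = h k) \<noteq> 0 \<longrightarrow>
        \<P>(\<omega> in M. X (Suc n) \<omega> = y \<bar> \<forall>k\<le>n. X k \<omega> = h k) = p (h n) y)"

definition perturbed_kernel ::
  "'p measure \<Rightarrow> ('p \<Rightarrow> int ^ 'd) \<Rightarrow> (int ^ 'd) set \<Rightarrow> (int ^ 'd \<Rightarrow> 'p \<Rightarrow> int ^ 'd) \<Rightarrow>
     int ^ 'd \<Rightarrow> int ^ 'd \<Rightarrow> real" where
  "perturbed_kernel P \<xi> A \<eta> x y =
     (if x \<in> A then \<P>(\<omega> in P. \<eta> x \<omega> = y - x) else \<P>(\<omega> in P. \<xi> \<omega> = y - x))"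

end

theory Submission
  imports Defs
begin

text \<open>
  After a late time \<open>k\<close> the chain \<open>X\<close> no longer visits \<open>A\<close> with probability close to 1, and as long
  as it stays off \<open>A\<close> its increments behave like those of \<open>S\<^sub>\<xi>\<close>. Hence the law of \<open>X(k + \<cdot>) - X(k)\<close> is
  within \<open>P(\<exists>j \<ge> k. X(j) \<in> A)\<close> of that of \<open>S\<^sub>\<xi>\<close> in total variation, although the last visit to \<open>A\<close>
  is not a stopping time. Since \<open>a\<^sub>n \<rightarrow> \<infinity>\<close>, deleting the first \<open>k\<close> steps changes the rescaled path by a
  \<open>J\<^sub>1\<close>-distance that tends to 0, and test functions that are Lipschitz for a quasi-metric of the
  \<open>J\<^sub>1\<close>-topology do not notice this. Inf-convolution with that quasi-metric approximates every
  bounded continuous function from below by such functions.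
\<close>

section \<open>A gauge for the \<open>J\<^sub>1\<close>-topology\<close>

text \<open>Lipschitz test functions are essential: the rescaled chain and its copy without the
  first k steps both move with n, so a distance tending to 0 between them says nothing about the
  values of a merely continuous function, whereas a Lipschitz bound turns it into a bound on the
  difference of the values. The time k is deterministic, hence the Markov property applies at it;
  the price is the event of a visit at or after k, whose probability does not depend on n. So k can
  be fixed before n tends to infinity. Estimates are made in one direction only, for functions with
  values in [0,1]; the other direction comes from 1 - f. The divergence of \<open>a\<close>, which
  makes the first k positions negligible, is forced for nondegenerate \<xi> by the convergence of
  the random walk, because limit paths are right-continuous at 0.\<close>

text \<open>One parameter serves as precision and, through 1 / \<epsilon>, as time horizon, so that
  small values control long windows. The inserted 1 makes the set nonempty and caps the gauge; the
  proof of the triangle inequality relies on this cap.\<close>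

definition J1_gauge :: "(real \<Rightarrow> 'a::metric_space) \<Rightarrow> (real \<Rightarrow> 'a) \<Rightarrow> real" where
  "J1_gauge x y = Inf (insert 1 {\<epsilon>. 0 < \<epsilon> \<and> y \<in> J1_nbhd x (1 / \<epsilon>) \<epsilon>})"

lemma J1_gauge_bdd_below: "bdd_below (insert (1::real) {\<epsilon>. 0 < \<epsilon> \<and> y \<in> J1_nbhd x (1 / \<epsilon>) \<epsilon>})"
  by (rule bdd_belowI[of _ 0]) auto

lemma J1_gauge_nonneg: "0 \<le> J1_gauge x y"
  unfolding J1_gauge_def by (rule cInf_greatest) auto

lemma J1_gauge_le_1: "J1_gauge x y \<le> 1"
  unfolding J1_gauge_def by (rule cInf_lower[OF _ J1_gauge_bdd_below]) auto

lemma J1_gauge_le: "0 < \<epsilon> \<Longrightarrow> y \<in> J1_nbhd x (1 / \<epsilon>) \<epsilon> \<Longrightarrow> J1_gauge x y \<le> \<epsilon>"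
  unfolding J1_gauge_def by (rule cInf_lower[OF _ J1_gauge_bdd_below]) auto

text \<open>The bound \<epsilon> \<le> 1 excludes the inserted value 1 as the element below
  \<epsilon>, so that a genuine neighbourhood relation remains.\<close>

lemma J1_gauge_less_imp_nbhd:
  assumes "J1_gauge x y < \<epsilon>" "\<epsilon> \<le> 1"
  shows "y \<in> J1_nbhd x (1 / \<epsilon>) \<epsilon>"
proof -
  obtain \<delta> where "\<delta> \<in> insert 1 {\<epsilon>. 0 < \<epsilon> \<and> y \<in> J1_nbhd x (1 / \<epsilon>) \<epsilon>}" "\<delta> < \<epsilon>"
    using assms(1) cInf_lessD[of "insert 1 {\<epsilon>. 0 < \<epsilon> \<and> y \<in> J1_nbhd x (1 / \<epsilon>) \<epsilon>}" \<epsilon>]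
    unfolding J1_gauge_def by blast
  then show ?thesis
    using assms(2) J1_nbhd_mono[of "1 / \<epsilon>" "1 / \<delta>" \<delta> \<epsilon> x] by (auto simp: field_simps)
qed

lemma J1_gauge_self: assumes "x \<in> skorokhod_space" shows "J1_gauge x x = 0"
proof (rule antisym[OF field_le_epsilon J1_gauge_nonneg])
  fix e :: real assume "e > 0"
  then show "J1_gauge x x \<le> 0 + e"
    using J1_gauge_le[of e x x] self_in_J1_nbhd[OF assms] by simp
qed

lemma J1_gauge_triangle: "J1_gauge x z \<le> J1_gauge x y + J1_gauge y z"
proof (rule ccontr)
  \<comment> \<open>A third of the assumed gap: one r enlarges each of the two gauges, and the last
    one is left for the contradiction.\<close>
  define r where "r = (J1_gauge x z - J1_gauge x y - J1_gauge y z) / 3"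
  assume "\<not> ?thesis"
  then have r: "r > 0" by (simp add: r_def)
  define \<delta> \<delta>' where d: "\<delta> = J1_gauge x y + r" "\<delta>' = J1_gauge y z + r"
  have pos: "\<delta> > 0" "\<delta>' > 0" using r J1_gauge_nonneg[of x y] J1_gauge_nonneg[of y z] by (auto simp: d)
  have sum: "\<delta> + \<delta>' = J1_gauge x z - r" by (simp add: d r_def field_simps)
  then have le1: "\<delta> + \<delta>' \<le> 1" using J1_gauge_le_1[of x z] r by linarith
  have y: "y \<in> J1_nbhd x (1 / (\<delta> + \<delta>')) \<delta>"
    using J1_gauge_less_imp_nbhd[of x y \<delta>] J1_nbhd_mono[of "1 / (\<delta> + \<delta>')" "1 / \<delta>" \<delta> \<delta> x] r pos le1
    by (auto simp: d(1) frac_le)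
  \<comment> \<open>Composing neighbourhoods needs a second window longer by \<delta>. The
    inequality 1 / (\<delta> + \<delta>') + \<delta> \<le> 1 / \<delta>' amounts to (\<delta> +
    \<delta>') \<delta>' \<le> 1, which the cap at 1 provides.\<close>
  have "(\<delta> + \<delta>') * \<delta>' \<le> 1 * 1" using pos le1 by (intro mult_mono) auto
  then have "\<delta> * ((\<delta> + \<delta>') * \<delta>') \<le> \<delta> * 1" using pos by (intro mult_left_mono) auto
  then have "1 / (\<delta> + \<delta>') + \<delta> \<le> 1 / \<delta>'"
    using pos by (simp add: field_simps)
  then have "z \<in> J1_nbhd y (1 / (\<delta> + \<delta>') + \<delta>) \<delta>'"
    using J1_gauge_less_imp_nbhd[of y z \<delta>'] J1_nbhd_mono[of "1 / (\<delta> + \<delta>') + \<delta>" "1 / \<delta>'" \<delta>' \<delta>' y] r pos le1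
    by (auto simp: d(2))
  from J1_nbhd_trans[OF y this] have "J1_gauge x z \<le> \<delta> + \<delta>'"
    by (rule J1_gauge_le[rotated]) (use pos in simp)
  then show False using sum r by simp
qed

section \<open>Near-symmetry and continuity of the gauge\<close>

lemma time_changes_inverse:
  assumes "\<tau> \<in> time_changes"
  obtains \<mu> where "\<mu> \<in> time_changes" "\<And>t. t \<ge> 0 \<Longrightarrow> \<mu> t \<ge> 0" "\<And>t. t \<ge> 0 \<Longrightarrow> \<tau> (\<mu> t) = t"
proof
  define \<mu> where "\<mu> = inv_into {0..} \<tau>"
  have sm: "strict_mono_on {0..} \<tau>" and im: "\<tau> ` {0..} = {0..}"
    using assms by (auto simp: time_changes_def)
  show nn: "\<mu> t \<ge> 0" if "t \<ge> 0" for t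
    using inv_into_into[of t \<tau> "{0..}"] im that by (simp add: \<mu>_def)
  show inv: "\<tau> (\<mu> t) = t" if "t \<ge> 0" for t
    using f_inv_into_f[of t \<tau> "{0..}"] im that by (simp add: \<mu>_def)
  have "\<mu> s < \<mu> t" if "0 \<le> s" "s < t" for s t
  proof (rule ccontr)
    assume "\<not> ?thesis"
    then have "\<tau> (\<mu> t) \<le> \<tau> (\<mu> s)"
      using strict_mono_on_leD[OF sm, of "\<mu> t" "\<mu> s"] nn that by auto
    then show False using inv that by simp
  qed
  moreover have "\<mu> ` {0..} = {0..}"
    unfolding \<mu>_def using inv_into_image_cancel[OF strict_mono_on_imp_inj_on[OF sm], of "{0..}"] im by simp
  ultimately show "\<mu> \<in> time_changes"
    by (auto simp: time_changes_def strict_mono_on_def)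
qed

text \<open>Invert the time change. The inverse also moves points by less than \<epsilon>, so it
  maps [0, T - \<epsilon>] into [0, T]; this is the loss in the window.\<close>

lemma J1_nbhd_sym:
  assumes y: "y \<in> J1_nbhd x T \<epsilon>" and x: "x \<in> skorokhod_space"
  shows "x \<in> J1_nbhd y (T - \<epsilon>) \<epsilon>"
proof -
  obtain \<tau> where t: "\<tau> \<in> time_changes" "\<And>t. t \<ge> 0 \<Longrightarrow> \<bar>\<tau> t - t\<bar> < \<epsilon>"
      "\<And>t. t \<in> {0..T} \<Longrightarrow> dist (y (\<tau> t)) (x t) < \<epsilon>"
    using y by (auto simp: J1_nbhd_def)
  obtain \<mu> where m: "\<mu> \<in> time_changes" "\<And>t. t \<ge> 0 \<Longrightarrow> \<mu> t \<ge> 0" "\<And>t. t \<ge> 0 \<Longrightarrow> \<tau> (\<mu> t) = t"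
    using time_changes_inverse[OF t(1)] by blast
  have 1: "\<bar>\<mu> t - t\<bar> < \<epsilon>" if "t \<ge> 0" for t
    using t(2)[OF m(2)[OF that]] m(3)[OF that] by (simp add: abs_minus_commute)
  have 2: "dist (x (\<mu> t)) (y t) < \<epsilon>" if "t \<in> {0..T - \<epsilon>}" for t
    using t(3)[of "\<mu> t"] 1[of t] m(2,3)[of t] that by (auto simp: dist_commute)
  show ?thesis using x m(1) 1 2 by (auto simp: J1_nbhd_def intro!: bexI[of _ \<mu>])
qed

text \<open>Inversion shortens the window 1 / \<delta> by \<delta>. Doubling the parameter halves
  the required horizon, and 1 / (2 \<delta>) \<le> 1 / \<delta> - \<delta> for \<delta> \<le> 1/2;
  for larger \<delta> the cap at 1 suffices.\<close>

lemma J1_gauge_sym: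
  assumes "x \<in> skorokhod_space"
  shows "J1_gauge y x \<le> 2 * J1_gauge x y"
proof (rule field_le_epsilon)
  fix e :: real assume e: "e > 0"
  define \<delta> where "\<delta> = J1_gauge x y + e / 2"
  have d: "\<delta> > 0" "J1_gauge x y < \<delta>" using e J1_gauge_nonneg[of x y] by (auto simp: \<delta>_def)
  have "J1_gauge y x \<le> 2 * \<delta>"
  proof (cases "\<delta> \<le> 1 / 2")
    case True
    then have "x \<in> J1_nbhd y (1 / \<delta> - \<delta>) \<delta>"
      using J1_nbhd_sym[OF J1_gauge_less_imp_nbhd[OF d(2)] assms] by simp
    moreover have "\<delta> * \<delta> \<le> (1 / 2) * (1 / 2)" using True d by (intro mult_mono) auto
    then have "1 / (2 * \<delta>) \<le> 1 / \<delta> - \<delta>" using d(1) by (simp add: field_simps)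
    ultimately have "x \<in> J1_nbhd y (1 / (2 * \<delta>)) (2 * \<delta>)"
      using J1_nbhd_mono[of "1 / (2 * \<delta>)" "1 / \<delta> - \<delta>" \<delta> "2 * \<delta>" y] d(1) by auto
    then show ?thesis using d(1) by (intro J1_gauge_le) auto
  next
    case False
    then show ?thesis using J1_gauge_le_1[of y x] by simp
  qed
  then show "J1_gauge y x \<le> 2 * J1_gauge x y + e" by (simp add: \<delta>_def)
qed

lemma J1_gauge_continuous_map:
  assumes L: "\<And>x y. x \<in> skorokhod_space \<Longrightarrow> y \<in> skorokhod_space \<Longrightarrow> \<bar>g x - g y\<bar> \<le> L * J1_gauge x y"
  shows "continuous_map J1_topology euclideanreal g"
  unfolding continuous_map_def
proof (intro conjI allI impI)
  fix U :: "real set" assume "openin euclideanreal U"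
  then have U: "open U" by simp
  show "openin J1_topology {x \<in> topspace J1_topology. g x \<in> U}"
    unfolding openin_J1_topology topspace_J1_topology
  proof (intro conjI ballI)
    fix x assume "x \<in> {x \<in> skorokhod_space. g x \<in> U}"
    then have x: "x \<in> skorokhod_space" "g x \<in> U" by auto
    obtain e where e: "e > 0" "ball (g x) e \<subseteq> U" using U x(2) openE by blast
    \<comment> \<open>Chosen so that the Lipschitz bound gives at most e / 2; the summand 1 keeps
      the divisor positive.\<close>
    define \<epsilon> where "\<epsilon> = e / (2 * (\<bar>L\<bar> + 1))"
    have pos: "\<epsilon> > 0" using e by (simp add: \<epsilon>_def)
    have "g y \<in> U" if y: "y \<in> J1_nbhd x (1 / \<epsilon>) \<epsilon>" for y
    proof -
      have "\<bar>g x - g y\<bar> \<le> L * J1_gauge x y"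
        using x y by (intro L) (auto simp: J1_nbhd_def)
      also have "\<dots> \<le> (\<bar>L\<bar> + 1) * \<epsilon>"
        using J1_gauge_le[OF pos y] J1_gauge_nonneg[of x y] by (intro mult_mono) auto
      also have "\<dots> = e / 2" by (simp add: \<epsilon>_def field_simps)
      finally show ?thesis using e by (auto simp: dist_real_def)
    qed
    then show "\<exists>T. \<exists>\<epsilon>>0. J1_nbhd x T \<epsilon> \<subseteq> {x \<in> skorokhod_space. g x \<in> U}"
      using pos by (intro exI[of _ "1 / \<epsilon>"] exI[of _ \<epsilon>]) (auto simp: J1_nbhd_def)
  qed auto
qed auto

section \<open>Lipschitz approximation\<close>

text \<open>The Pasch-Hausdorff envelope with the gauge in place of a metric. The argument x comes
  first in the gauge because the neighbourhoods of the topology are centred there.\<close>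

definition J1_envelope :: "((real \<Rightarrow> 'a::metric_space) \<Rightarrow> real) \<Rightarrow> real \<Rightarrow> (real \<Rightarrow> 'a) \<Rightarrow> real" where
  "J1_envelope f L x = (INF y\<in>skorokhod_space. f y + L * J1_gauge x y)"

context
  fixes f :: "(real \<Rightarrow> 'a::metric_space) \<Rightarrow> real" and L :: real
  assumes f01: "\<And>x. x \<in> skorokhod_space \<Longrightarrow> f x \<in> {0..1}" and L: "L \<ge> 0"
begin

lemma J1_envelope_bdd_below: "bdd_below ((\<lambda>y. f y + L * J1_gauge x y) ` skorokhod_space)"
  using f01 L J1_gauge_nonneg[of x] by (intro bdd_belowI2[of _ 0]) auto

lemma J1_envelope_greatest:
  assumes "x \<in> skorokhod_space" "\<And>y. y \<in> skorokhod_space \<Longrightarrow> c \<le> f y + L * J1_gauge x y"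
  shows "c \<le> J1_envelope f L x"
  unfolding J1_envelope_def using assms by (intro cINF_greatest) auto

lemma J1_envelope_lower: "y \<in> skorokhod_space \<Longrightarrow> J1_envelope f L x \<le> f y + L * J1_gauge x y"
  unfolding J1_envelope_def by (rule cINF_lower[OF J1_envelope_bdd_below])

lemma J1_envelope_le: "x \<in> skorokhod_space \<Longrightarrow> J1_envelope f L x \<le> f x"
  using J1_envelope_lower[of x x] by (simp add: J1_gauge_self)

lemma J1_envelope_01: "x \<in> skorokhod_space \<Longrightarrow> J1_envelope f L x \<in> {0..1}"
  using J1_envelope_le[of x] f01[of x] J1_envelope_greatest[of x 0] f01 L J1_gauge_nonneg[of x]
  by fastforce

text \<open>The triangle inequality bounds the difference in one direction by L times the gauge from
  x to x'. The opposite difference involves the gauge from x' to x, which costs the factor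
  2.\<close>

lemma J1_envelope_Lipschitz:
  assumes "x \<in> skorokhod_space" "x' \<in> skorokhod_space"
  shows "\<bar>J1_envelope f L x - J1_envelope f L x'\<bar> \<le> (2 * L) * J1_gauge x x'"
proof -
  have *: "J1_envelope f L x - L * J1_gauge x x' \<le> J1_envelope f L x'"
    if "x' \<in> skorokhod_space" for x x'
  proof (rule J1_envelope_greatest[OF that])
    fix y assume y: "y \<in> (skorokhod_space :: (real \<Rightarrow> 'a) set)"
    show "J1_envelope f L x - L * J1_gauge x x' \<le> f y + L * J1_gauge x' y"
      using J1_envelope_lower[OF y, of x] mult_left_mono[OF J1_gauge_triangle[of x y x'] L]
      by (simp add: algebra_simps)
  qed
  show ?thesis
    using *[OF assms(1), of x'] *[OF assms(2), of x] mult_left_mono[OF J1_gauge_sym[OF assms(1), of x'] L]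
      mult_nonneg_nonneg[OF L J1_gauge_nonneg[of x x']]
    by (simp add: algebra_simps abs_le_iff)
qed

text \<open>\<open>f\<close> may be discontinuous here: this is how an indicator of large
  oscillation becomes a continuous test function in the study of the norming sequence.\<close>

lemma J1_envelope_continuous_map: "continuous_map J1_topology euclideanreal (J1_envelope f L)"
  by (rule J1_gauge_continuous_map[OF J1_envelope_Lipschitz])

end

text \<open>Paths at gauge at least \<epsilon> from x pay a penalty m \<epsilon> \<ge> 1, no less
  than any possible drop of \<open>f\<close>; closer ones lie in a neighbourhood of x on which
  \<open>f\<close> exceeds f x - e / 2.\<close>

lemma J1_envelope_tendsto:
  assumes f01: "\<And>x. x \<in> skorokhod_space \<Longrightarrow> f x \<in> {0..1}"
    and f: "continuous_map J1_topology euclideanreal f" and x: "x \<in> skorokhod_space"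
  shows "(\<lambda>m. J1_envelope f (real m) x) \<longlonglongrightarrow> f x"
proof (rule LIMSEQ_I)
  fix e :: real assume e: "e > 0"
  have "openin J1_topology {y \<in> topspace J1_topology. f y \<in> {f x - e / 2<..}}"
    using openin_continuous_map_preimage[OF f, of "{f x - e / 2<..}"] by simp
  then obtain T \<delta> where d: "\<delta> > 0" "J1_nbhd x T \<delta> \<subseteq> {y \<in> skorokhod_space. f y > f x - e / 2}"
    unfolding openin_J1_topology topspace_J1_topology using x e by force
  \<comment> \<open>Small enough that \<open>J1_nbhd x (1 / \<epsilon>) \<epsilon>\<close> lies
    inside \<open>J1_nbhd x T \<delta>\<close>; the divisor is positive for every sign of T.\<close>
  define \<epsilon> where "\<epsilon> = min 1 (min \<delta> (1 / (\<bar>T\<bar> + 1)))"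
  have pos: "\<epsilon> > 0" "\<epsilon> \<le> 1" "\<epsilon> \<le> \<delta>" using d by (auto simp: \<epsilon>_def)
  have "\<epsilon> \<le> 1 / (\<bar>T\<bar> + 1)" by (simp add: \<epsilon>_def)
  then have "\<epsilon> * (\<bar>T\<bar> + 1) \<le> 1" by (simp add: pos_le_divide_eq)
  moreover have "\<epsilon> * T \<le> \<epsilon> * (\<bar>T\<bar> + 1)" using pos(1) by (intro mult_left_mono) auto
  ultimately have "T * \<epsilon> \<le> 1" by (simp add: mult.commute)
  then have T: "T \<le> 1 / \<epsilon>" using pos(1) by (simp add: field_simps)
  obtain m0 :: nat where m0: "1 / \<epsilon> \<le> real m0" using real_arch_simple by blast
  show "\<exists>m0. \<forall>m\<ge>m0. norm (J1_envelope f (real m) x - f x) < e"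
  proof (intro exI allI impI)
    fix m assume "m \<ge> m0"
    then have m: "1 / \<epsilon> \<le> real m" using m0 by linarith
    have "f x - e / 2 \<le> J1_envelope f (real m) x"
    proof (rule J1_envelope_greatest)
      fix y assume y: "y \<in> (skorokhod_space :: (real \<Rightarrow> 'a) set)"
      show "f x - e / 2 \<le> f y + real m * J1_gauge x y"
      proof (cases "J1_gauge x y < \<epsilon>")
        case True
        then have "y \<in> J1_nbhd x T \<delta>"
          using J1_gauge_less_imp_nbhd[OF True pos(2)] J1_nbhd_mono[OF T pos(3)] by blast
        then show ?thesis using d(2) mult_nonneg_nonneg[of "real m", OF _ J1_gauge_nonneg[of x y]] by auto
      next
        case False
        then have "1 / \<epsilon> * \<epsilon> \<le> real m * J1_gauge x y"
          using m pos by (intro mult_mono) auto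
        then show ?thesis using f01[OF x] f01[OF y] e pos by auto
      qed
    qed (use f01 x in auto)
    then show "norm (J1_envelope f (real m) x - f x) < e"
      using J1_envelope_le[of f "real m" x, OF f01 _ x] e by auto
  qed
qed

section \<open>Laws of discrete processes\<close>

lemma measurable_map_count_space:
  fixes X :: "'i \<Rightarrow> 'w \<Rightarrow> 's::countable"
  assumes "\<And>i. i \<in> set is \<Longrightarrow> X i \<in> M \<rightarrow>\<^sub>M count_space UNIV"
  shows "(\<lambda>\<omega>. map (\<lambda>i. X i \<omega>) is) \<in> M \<rightarrow>\<^sub>M count_space UNIV"
  using assms
proof (induction "is")
  case (Cons i "is")
  have "(\<lambda>\<omega>. x # map (\<lambda>i. X i \<omega>) is) \<in> M \<rightarrow>\<^sub>M count_space UNIV" for x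
    by (rule measurable_compose[OF Cons.IH]) (use Cons.prems in auto)
  from measurable_compose_countable[OF this, of "X i"] show ?case
    using Cons.prems by simp
qed simp

text \<open>Split over the countably many values of \<open>F\<close> and interchange sum and
  integral. Expectations of functions of a discrete process are thereby compared through the masses
  of single histories; \<phi> = 1 gives back the mass of \<open>G\<close>.\<close>

lemma nn_integral_countable_fibres:
  fixes F :: "'w \<Rightarrow> 's::countable"
  assumes [measurable]: "F \<in> M \<rightarrow>\<^sub>M count_space UNIV" "G \<in> sets M"
  shows "(\<integral>\<^sup>+\<omega>. \<phi> (F \<omega>) * indicator G \<omega> \<partial>M) =
    (\<integral>\<^sup>+l. \<phi> l * emeasure M {\<omega> \<in> G. F \<omega> = l} \<partial>count_space UNIV)"
proof -
  have G: "G \<subseteq> space M" using assms(2) by (rule sets.sets_into_space)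
  have [measurable]: "{\<omega> \<in> G. F \<omega> = l} \<in> sets M" for l
  proof -
    have "{\<omega> \<in> G. F \<omega> = l} = G \<inter> (F -` {l} \<inter> space M)" using G by auto
    then show ?thesis by simp
  qed
  have "(\<integral>\<^sup>+\<omega>. \<phi> (F \<omega>) * indicator G \<omega> \<partial>M) =
    (\<integral>\<^sup>+\<omega>. (\<integral>\<^sup>+l. \<phi> l * indicator {\<omega> \<in> G. F \<omega> = l} \<omega> \<partial>count_space UNIV) \<partial>M)"
  proof (rule nn_integral_cong)
    fix \<omega>
    have "(\<lambda>l. \<phi> l * indicator {\<omega> \<in> G. F \<omega> = l} \<omega>) =
        (\<lambda>l. (\<phi> (F \<omega>) * indicator G \<omega>) * indicator {F \<omega>} l)"
      by (auto simp: fun_eq_iff split: split_indicator)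
    then show "\<phi> (F \<omega>) * indicator G \<omega> =
        (\<integral>\<^sup>+l. \<phi> l * indicator {\<omega> \<in> G. F \<omega> = l} \<omega> \<partial>count_space UNIV)"
      by (simp add: nn_integral_cmult_indicator one_ennreal_def[symmetric])
  qed
  also have "\<dots> = (\<integral>\<^sup>+l. (\<integral>\<^sup>+\<omega>. \<phi> l * indicator {\<omega> \<in> G. F \<omega> = l} \<omega> \<partial>M) \<partial>count_space UNIV)"
    by (rule nn_integral_count_space_nn_integral) auto
  also have "\<dots> = (\<integral>\<^sup>+l. \<phi> l * emeasure M {\<omega> \<in> G. F \<omega> = l} \<partial>count_space UNIV)"
    by (simp add: nn_integral_cmult_indicator)
  finally show ?thesis .
qed

lemma map_nth_eq_iff:
  "map f [m..<n] = l \<longleftrightarrow> length l = n - m \<and> (\<forall>i\<in>{m..<n}. f i = l ! (i - m))"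
proof (intro iffI conjI ballI)
  assume r: "length l = n - m \<and> (\<forall>i\<in>{m..<n}. f i = l ! (i - m))"
  show "map f [m..<n] = l"
  proof (rule nth_equalityI)
    fix j assume "j < length (map f [m..<n])"
    then show "map f [m..<n] ! j = l ! j" using r by simp
  qed (use r in simp)
qed auto

lemma sets_finite_history:
  fixes X :: "nat \<Rightarrow> 'w \<Rightarrow> 's::countable"
  assumes X: "\<And>i. X i \<in> M \<rightarrow>\<^sub>M count_space UNIV"
    and dep: "\<And>w w'. (\<forall>i\<le>n. w i = w' i) \<Longrightarrow> Q w = Q w'"
  shows "{\<omega> \<in> space M. Q (\<lambda>i. X i \<omega>)} \<in> sets M"
proof -
  \<comment> \<open>\<open>nth\<close> has no specified value beyond the end of the list; by
    \<open>dep\<close> the predicate does not look there.\<close>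
  have "Q (\<lambda>i. X i \<omega>) = Q (nth (map (\<lambda>i. X i \<omega>) [0..<Suc n]))" for \<omega>
    by (rule dep) (auto simp del: upt_Suc)
  then have "{\<omega> \<in> space M. Q (\<lambda>i. X i \<omega>)} =
      (\<lambda>\<omega>. map (\<lambda>i. X i \<omega>) [0..<Suc n]) -` {l. Q (nth l)} \<inter> space M"
    by auto
  then show ?thesis
    using measurable_sets[OF measurable_map_count_space[of "[0..<Suc n]" X M], of "{l. Q (nth l)}"] X
    by (simp del: upt_Suc)
qed

section \<open>Increments of the perturbed chain while it stays off A\<close>

text \<open>The Markov property says nothing about histories of probability 0. In product form both
  sides vanish there, so that the identity can be summed over all histories.\<close>

lemma markov_chain_emeasure_step:
  fixes X :: "nat \<Rightarrow> 'w \<Rightarrow> 's::countable"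
  assumes mc: "markov_chain M p X"
  shows "emeasure M {\<omega> \<in> space M. (\<forall>k\<le>n. X k \<omega> = h k) \<and> X (Suc n) \<omega> = y} =
    emeasure M {\<omega> \<in> space M. \<forall>k\<le>n. X k \<omega> = h k} * ennreal (p (h n) y)"
proof -
  interpret prob_space M using mc by (simp add: markov_chain_def)
  let ?H = "{\<omega> \<in> space M. \<forall>k\<le>n. X k \<omega> = h k}"
  let ?J = "{\<omega> \<in> space M. (\<forall>k\<le>n. X k \<omega> = h k) \<and> X (Suc n) \<omega> = y}"
  have X: "X i \<in> M \<rightarrow>\<^sub>M count_space UNIV" for i using mc by (simp add: markov_chain_def)
  have H: "?H \<in> events"
    by (rule sets_finite_history[OF X, where n = n]) auto
  have J: "?J \<in> events"
    by (rule sets_finite_history[OF X, where n = "Suc n"]) auto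
  have "prob ?J = prob ?H * p (h n) y"
  proof (cases "prob ?H = 0")
    case True
    then show ?thesis using finite_measure_mono[OF _ H, of ?J] measure_nonneg[of M ?J] by auto
  next
    case False
    then have "\<P>(\<omega> in M. X (Suc n) \<omega> = y \<bar> \<forall>k\<le>n. X k \<omega> = h k) = p (h n) y"
      using mc by (simp add: markov_chain_def)
    moreover have "{\<omega> \<in> space M. X (Suc n) \<omega> = y \<and> (\<forall>k\<le>n. X k \<omega> = h k)} = ?J" by auto
    ultimately show ?thesis using False by (simp add: cond_prob_def field_simps)
  qed
  then show ?thesis
    unfolding emeasure_eq_measure by (simp add: ennreal_mult')
qed

text \<open>Off A the kernel depends only on the difference y - x, so every history satisfying
  \<open>Q\<close> contributes the same factor. Since \<open>Q\<close> sees only the coordinates up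
  to n, each such history decides it, and the fibres can be summed.\<close>

lemma perturbed_walk_increment:
  fixes X :: "nat \<Rightarrow> 'w \<Rightarrow> int ^ 'd"
  assumes P: "prob_space P"
    and mc: "markov_chain M (perturbed_kernel P \<xi> A \<eta>) X"
    and dep: "\<And>w w'. (\<forall>i\<le>n. w i = w' i) \<Longrightarrow> Q w = Q w'"
    and off: "\<And>w. Q w \<Longrightarrow> w n \<notin> A"
  shows "emeasure M {\<omega> \<in> space M. Q (\<lambda>i. X i \<omega>) \<and> X (Suc n) \<omega> - X n \<omega> = u} =
    emeasure M {\<omega> \<in> space M. Q (\<lambda>i. X i \<omega>)} * emeasure P {\<omega> \<in> space P. \<xi> \<omega> = u}"
proof -
  interpret P: prob_space P by (rule P)
  let ?F = "\<lambda>\<omega>. map (\<lambda>i. X i \<omega>) [0..<Suc n]"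
  let ?E = "{\<omega> \<in> space M. Q (\<lambda>i. X i \<omega>)}"
  let ?E' = "{\<omega> \<in> space M. Q (\<lambda>i. X i \<omega>) \<and> X (Suc n) \<omega> - X n \<omega> = u}"
  have X: "X i \<in> M \<rightarrow>\<^sub>M count_space UNIV" for i using mc by (simp add: markov_chain_def)
  have F: "?F \<in> M \<rightarrow>\<^sub>M count_space UNIV" by (rule measurable_map_count_space[OF X])
  have E: "?E \<in> sets M" by (rule sets_finite_history[OF X dep])
  have E': "?E' \<in> sets M"
  proof (rule sets_finite_history[OF X, where n = "Suc n"])
    fix w w' :: "nat \<Rightarrow> int ^ 'd" assume w: "\<forall>i\<le>Suc n. w i = w' i"
    have "Q w = Q w'" by (rule dep) (use w le_SucI in blast)
    moreover have "w (Suc n) = w' (Suc n)" "w n = w' n" using w by auto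
    ultimately show "(Q w \<and> w (Suc n) - w n = u) = (Q w' \<and> w' (Suc n) - w' n = u)"
      by (simp only:)
  qed
  have fib: "emeasure M {\<omega> \<in> ?E'. ?F \<omega> = l} =
      emeasure M {\<omega> \<in> ?E. ?F \<omega> = l} * emeasure P {\<omega> \<in> space P. \<xi> \<omega> = u}" for l
  proof (cases "length l = Suc n \<and> Q (nth l)")
    case True
    have iff: "?F \<omega> = l \<longleftrightarrow> (\<forall>k\<le>n. X k \<omega> = l ! k)" for \<omega>
      unfolding map_nth_eq_iff using True by auto
    have QF: "Q (\<lambda>i. X i \<omega>)" if "\<forall>k\<le>n. X k \<omega> = l ! k" for \<omega>
      using dep[of "\<lambda>i. X i \<omega>" "nth l"] True that by auto
    have 1: "{\<omega> \<in> ?E. ?F \<omega> = l} = {\<omega> \<in> space M. \<forall>k\<le>n. X k \<omega> = l ! k}"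
      unfolding iff using QF by auto
    have 2: "{\<omega> \<in> ?E'. ?F \<omega> = l} = {\<omega> \<in> space M. (\<forall>k\<le>n. X k \<omega> = l ! k) \<and> X (Suc n) \<omega> = l ! n + u}"
      unfolding iff using QF by (auto simp: algebra_simps)
    have "perturbed_kernel P \<xi> A \<eta> (l ! n) (l ! n + u) = P.prob {\<omega> \<in> space P. \<xi> \<omega> = u}"
      using off[of "nth l"] True by (simp add: perturbed_kernel_def)
    then show ?thesis
      unfolding 1 2 markov_chain_emeasure_step[OF mc] by (simp add: P.emeasure_eq_measure)
  next
    case False
    have "?F \<omega> \<noteq> l" if "Q (\<lambda>i. X i \<omega>)" for \<omega>
    proof
      assume l: "?F \<omega> = l"
      then have "\<forall>i\<le>n. X i \<omega> = l ! i" "length l = Suc n" unfolding map_nth_eq_iff by auto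
      then show False using False dep[of "\<lambda>i. X i \<omega>" "nth l"] that by auto
    qed
    then have "{\<omega> \<in> ?E. ?F \<omega> = l} = {}" "{\<omega> \<in> ?E'. ?F \<omega> = l} = {}" by blast+
    then show ?thesis by (simp only: emeasure_empty mult_zero_left)
  qed
  have "emeasure M ?E' = (\<integral>\<^sup>+l. emeasure M {\<omega> \<in> ?E'. ?F \<omega> = l} \<partial>count_space UNIV)"
    using nn_integral_countable_fibres[OF F E', of "\<lambda>_. 1"] E' by simp
  also have "\<dots> = (\<integral>\<^sup>+l. emeasure M {\<omega> \<in> ?E. ?F \<omega> = l} \<partial>count_space UNIV) * emeasure P {\<omega> \<in> space P. \<xi> \<omega> = u}"
    unfolding fib by (rule nn_integral_multc) simp
  also have "(\<integral>\<^sup>+l. emeasure M {\<omega> \<in> ?E. ?F \<omega> = l} \<partial>count_space UNIV) = emeasure M ?E"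
    using nn_integral_countable_fibres[OF F E, of "\<lambda>_. 1"] E by simp
  finally show ?thesis .
qed

text \<open>Induction on m with the one-step formula. The positions k, ..., k + m - 1 are those from
  which the m steps are made; the endpoint k + m is left unconstrained.\<close>

lemma perturbed_walk_increments_le:
  fixes X :: "nat \<Rightarrow> 'w \<Rightarrow> int ^ 'd"
  assumes P: "prob_space P"
    and mc: "markov_chain M (perturbed_kernel P \<xi> A \<eta>) X"
  shows "emeasure M {\<omega> \<in> space M. (\<forall>i\<in>{1..m}. X (k + i) \<omega> - X (k + i - 1) \<omega> = h i) \<and>
      (\<forall>j<m. X (k + j) \<omega> \<notin> A)}
    \<le> (\<Prod>i\<in>{1..m}. emeasure P {\<omega> \<in> space P. \<xi> \<omega> = h i})"
proof (induction m)
  case 0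
  interpret prob_space M using mc by (simp add: markov_chain_def)
  show ?case by (simp add: emeasure_space_1)
next
  case (Suc m)
  interpret prob_space M using mc by (simp add: markov_chain_def)
  have X: "X i \<in> M \<rightarrow>\<^sub>M count_space UNIV" for i using mc by (simp add: markov_chain_def)
  define Q where "Q w \<longleftrightarrow> (\<forall>i\<in>{1..m}. w (k + i) - w (k + i - 1) = h i) \<and> (\<forall>j<Suc m. w (k + j) \<notin> A)"
    for w :: "nat \<Rightarrow> int ^ 'd"
  define R where "R w \<longleftrightarrow> (\<forall>i\<in>{1..m}. w (k + i) - w (k + i - 1) = h i) \<and> (\<forall>j<m. w (k + j) \<notin> A)"
    for w :: "nat \<Rightarrow> int ^ 'd"
  have dep: "Q w = Q w'" "R w = R w'" if "\<forall>i\<le>k + m. w i = w' i" for w w'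
  proof -
    have diff: "w (k + i) - w (k + i - 1) = w' (k + i) - w' (k + i - 1)" if "i \<in> {1..m}" for i
    proof -
      have "k + i \<le> k + m" "k + i - 1 \<le> k + m" using that by auto
      then show ?thesis using \<open>\<forall>i\<le>k + m. w i = w' i\<close> by metis
    qed
    have inc: "(\<forall>i\<in>{1..m}. w (k + i) - w (k + i - 1) = h i) =
        (\<forall>i\<in>{1..m}. w' (k + i) - w' (k + i - 1) = h i)"
      by (rule ball_cong[OF refl]) (rule arg_cong[OF diff])
    have "w (k + j) = w' (k + j)" if "j < Suc m" for j
      by (rule \<open>\<forall>i\<le>k + m. w i = w' i\<close>[rule_format]) (use that in simp)
    then have "(\<forall>j<Suc m. w (k + j) \<notin> A) = (\<forall>j<Suc m. w' (k + j) \<notin> A)"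
        "(\<forall>j<m. w (k + j) \<notin> A) = (\<forall>j<m. w' (k + j) \<notin> A)" by (metis less_SucI)+
    then show "Q w = Q w'" "R w = R w'"
      unfolding Q_def R_def inc by blast+
  qed
  have ivl: "{1..Suc m} = insert (Suc m) {1..m}" by auto
  have "{\<omega> \<in> space M. (\<forall>i\<in>{1..Suc m}. X (k + i) \<omega> - X (k + i - 1) \<omega> = h i) \<and>
      (\<forall>j<Suc m. X (k + j) \<omega> \<notin> A)} =
      {\<omega> \<in> space M. Q (\<lambda>i. X i \<omega>) \<and> X (Suc (k + m)) \<omega> - X (k + m) \<omega> = h (Suc m)}"
    unfolding ivl by (auto simp: Q_def)
  also have "emeasure M \<dots> =
      emeasure M {\<omega> \<in> space M. Q (\<lambda>i. X i \<omega>)} * emeasure P {\<omega> \<in> space P. \<xi> \<omega> = h (Suc m)}"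
    by (rule perturbed_walk_increment[OF P mc]) (erule dep(1), simp add: Q_def)
  \<comment> \<open>Going from \<open>Q\<close> to \<open>R\<close> forgets that X (k + m) lies off
    A, a condition that the law of the new step required; here equality is lost.\<close>
  also have "emeasure M {\<omega> \<in> space M. Q (\<lambda>i. X i \<omega>)} \<le> emeasure M {\<omega> \<in> space M. R (\<lambda>i. X i \<omega>)}"
  proof (rule emeasure_mono)
    show "{\<omega> \<in> space M. R (\<lambda>i. X i \<omega>)} \<in> events"
      by (rule sets_finite_history[OF X, where n = "k + m"]) (rule dep)
  qed (auto simp: Q_def R_def)
  also have "emeasure M {\<omega> \<in> space M. R (\<lambda>i. X i \<omega>)} \<le> (\<Prod>i\<in>{1..m}. emeasure P {\<omega> \<in> space P. \<xi> \<omega> = h i})"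
    using Suc.IH by (simp add: R_def)
  finally show ?case
    unfolding ivl by (simp add: mult.commute mult_right_mono)
qed

text \<open>Stated for sets \<open>B i\<close> because two kinds occur: singletons, for the law of a
  vector of steps, and the complement of one value, for the event that this value has not yet
  appeared.\<close>

lemma iid_cylinder:
  fixes \<xi>s :: "nat \<Rightarrow> 'm \<Rightarrow> 's"
  assumes M: "prob_space M" and P: "prob_space P"
    and \<xi>: "\<xi> \<in> P \<rightarrow>\<^sub>M count_space UNIV"
    and ind: "prob_space.indep_vars M (\<lambda>_. count_space UNIV) \<xi>s {1..}"
    and eq: "\<And>i. i \<ge> 1 \<Longrightarrow> distr M (count_space UNIV) (\<xi>s i) = distr P (count_space UNIV) \<xi>"
  shows "measure M {\<omega> \<in> space M. \<forall>i\<in>{1..m}. \<xi>s i \<omega> \<in> B i} =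
    (\<Prod>i\<in>{1..m}. measure P {\<omega> \<in> space P. \<xi> \<omega> \<in> B i})"
proof (cases "m = 0")
  \<comment> \<open>The product rule for independence speaks of nonempty index sets, and an empty
    intersection would be the whole type instead of \<open>space M\<close>.\<close>
  case True
  then show ?thesis using prob_space.prob_space[OF M] by simp
next
  case False
  interpret M: prob_space M by (rule M)
  have \<xi>s: "\<xi>s i \<in> M \<rightarrow>\<^sub>M count_space UNIV" if "i \<ge> 1" for i
    using ind that unfolding M.indep_vars_def2 by auto
  have one: "measure M (\<xi>s i -` B i \<inter> space M) = measure P {\<omega> \<in> space P. \<xi> \<omega> \<in> B i}" if "i \<ge> 1" for i
  proof -
    have "measure M (\<xi>s i -` B i \<inter> space M) = measure (distr M (count_space UNIV) (\<xi>s i)) (B i)"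
      by (subst measure_distr) (use \<xi>s[OF that] in auto)
    also have "\<dots> = measure P (\<xi> -` B i \<inter> space P)"
      unfolding eq[OF that] by (subst measure_distr) (use \<xi> in auto)
    finally show ?thesis by (simp add: vimage_def Int_def conj_commute)
  qed
  have "measure M {\<omega> \<in> space M. \<forall>i\<in>{1..m}. \<xi>s i \<omega> \<in> B i} = measure M (\<Inter>i\<in>{1..m}. \<xi>s i -` B i \<inter> space M)"
    using False by (intro arg_cong[where f = "measure M"]) auto
  also have "\<dots> = (\<Prod>i\<in>{1..m}. measure M (\<xi>s i -` B i \<inter> space M))"
    by (rule M.indep_varsD[OF ind]) (use False in auto)
  finally show ?thesis using one by simp
qed

section \<open>Comparison with the random walk in total variation\<close>

text \<open>
  As long as \<open>X\<close> does not return to \<open>A\<close> after time \<open>k\<close>, its increments are dominated in law by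
  those of the random walk; comparing the finite-dimensional laws suffices because \<open>\<Psi>\<close> is a limit
  of functions of finitely many coordinates.
\<close>

lemma perturbed_walk_compare:
  fixes X :: "nat \<Rightarrow> 'k \<Rightarrow> int ^ 'd" and \<xi>s :: "nat \<Rightarrow> 'm \<Rightarrow> int ^ 'd"
  assumes M: "prob_space M" and P: "prob_space P"
    and \<xi>: "\<xi> \<in> P \<rightarrow>\<^sub>M count_space UNIV"
    and ind: "prob_space.indep_vars M (\<lambda>_. count_space UNIV) \<xi>s {1..}"
    and eq: "\<And>i. i \<ge> 1 \<Longrightarrow> distr M (count_space UNIV) (\<xi>s i) = distr P (count_space UNIV) \<xi>"
    and mc: "markov_chain M' (perturbed_kernel P \<xi> A \<eta>) X"
    and \<Psi>01: "\<And>z. \<Psi> z \<in> {0..1::real}"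
    and \<Psi>lim: "\<And>z. (\<lambda>m. \<Psi> (\<lambda>i. if i \<in> {1..m} then z i else 0)) \<longlonglongrightarrow> \<Psi> z"
  shows "(\<integral>\<omega>. \<Psi> (\<lambda>i. X (k + i) \<omega> - X (k + i - 1) \<omega>) \<partial>M') \<le>
    (\<integral>\<omega>. \<Psi> (\<lambda>i. \<xi>s i \<omega>) \<partial>M) + measure M' {\<omega> \<in> space M'. \<exists>j\<ge>k. X j \<omega> \<in> A}"
proof -
  interpret M: prob_space M by (rule M)
  interpret P: prob_space P by (rule P)
  interpret M': prob_space M' using mc by (simp add: markov_chain_def)
  have X[measurable]: "X i \<in> M' \<rightarrow>\<^sub>M count_space UNIV" for i using mc by (simp add: markov_chain_def)
  have \<xi>s[measurable]: "\<xi>s i \<in> M \<rightarrow>\<^sub>M count_space UNIV" if "i \<ge> 1" for i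
    using ind that unfolding M.indep_vars_def2 by auto
  define \<zeta> where "\<zeta> i \<omega> = X (k + i) \<omega> - X (k + i - 1) \<omega>" for i \<omega>
  have \<zeta>: "\<zeta> i \<in> M' \<rightarrow>\<^sub>M count_space UNIV" for i
  proof -
    have "(\<lambda>\<omega>. x - X (k + i - 1) \<omega>) \<in> M' \<rightarrow>\<^sub>M count_space UNIV" for x
      by (rule measurable_compose[OF X]) auto
    from measurable_compose_countable[OF this X] show ?thesis by (simp add: \<zeta>_def[abs_def])
  qed
  \<comment> \<open>The exceptional event does not depend on the truncation level m, so the error
    term passes unchanged through the limit in m.\<close>
  define Z where "Z = {\<omega> \<in> space M'. \<exists>j\<ge>k. X j \<omega> \<in> A}"
  have Z: "Z \<in> sets M'" unfolding Z_def by measurable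
  define T where "T m z = (\<lambda>i. if i \<in> {1..m} then z i else 0)" for m and z :: "nat \<Rightarrow> int ^ 'd"
  \<comment> \<open>The truncated functional, read as a function of the list of the first m steps;
    step i stands at position i - 1 of a list over \<open>[1..<Suc m]\<close>.\<close>
  define \<phi> where "\<phi> m l = \<Psi> (\<lambda>i. if i \<in> {1..m} then l ! (i - 1) else 0)" for m l
  have \<Psi>T: "\<Psi> (T m z) = \<phi> m (map z [1..<Suc m])" for m z
    unfolding \<phi>_def T_def by (rule arg_cong[where f = \<Psi>]) (auto simp: fun_eq_iff simp del: upt_Suc)
  have ml: "(\<lambda>\<omega>. map (\<lambda>i. \<zeta> i \<omega>) [1..<Suc m]) \<in> M' \<rightarrow>\<^sub>M count_space UNIV"
           "(\<lambda>\<omega>. map (\<lambda>i. \<xi>s i \<omega>) [1..<Suc m]) \<in> M \<rightarrow>\<^sub>M count_space UNIV" for m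
    by (rule measurable_map_count_space; use \<zeta> \<xi>s in auto)+
  have m\<Psi>T: "(\<lambda>\<omega>. \<Psi> (T m (\<lambda>i. \<zeta> i \<omega>))) \<in> borel_measurable M'"
            "(\<lambda>\<omega>. \<Psi> (T m (\<lambda>i. \<xi>s i \<omega>))) \<in> borel_measurable M" for m
    unfolding \<Psi>T by (rule measurable_compose[OF ml(1)], simp, rule measurable_compose[OF ml(2)], simp)
  have bound: "norm (\<Psi> z) \<le> 1" for z using \<Psi>01[of z] by simp
  have pos: "0 \<le> \<Psi> z" for z using \<Psi>01[of z] by simp
  have le1: "\<Psi> z \<le> 1" for z using \<Psi>01[of z] by simp
  have lim: "(\<lambda>m. \<Psi> (T m z)) \<longlonglongrightarrow> \<Psi> z" for z unfolding T_def by (rule \<Psi>lim)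
  have m\<Psi>: "(\<lambda>\<omega>. \<Psi> (\<lambda>i. \<zeta> i \<omega>)) \<in> borel_measurable M'"
           "(\<lambda>\<omega>. \<Psi> (\<lambda>i. \<xi>s i \<omega>)) \<in> borel_measurable M"
    by (rule borel_measurable_LIMSEQ_real[OF lim m\<Psi>T(1)])
      (rule borel_measurable_LIMSEQ_real[OF lim m\<Psi>T(2)])
  have fin: "(\<integral>\<omega>. \<Psi> (T m (\<lambda>i. \<zeta> i \<omega>)) \<partial>M') \<le> (\<integral>\<omega>. \<Psi> (T m (\<lambda>i. \<xi>s i \<omega>)) \<partial>M) + measure M' Z" for m
  proof -
    let ?F = "\<lambda>\<omega>. map (\<lambda>i. \<zeta> i \<omega>) [1..<Suc m]" and ?F' = "\<lambda>\<omega>. map (\<lambda>i. \<xi>s i \<omega>) [1..<Suc m]"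
    have nonneg: "0 \<le> (\<integral>\<omega>. \<Psi> (T m (\<lambda>i. \<xi>s i \<omega>)) \<partial>M)"
      by (rule integral_nonneg_AE[OF AE_I2[OF pos]])
    \<comment> \<open>Off \<open>Z\<close> all positions from time k on avoid A, so the bound for
      steps made off A applies to each history, and by independence that bound is exactly its mass
      under the random walk.\<close>
    have law: "emeasure M' {\<omega> \<in> space M' - Z. ?F \<omega> = l} \<le> emeasure M {\<omega> \<in> space M. ?F' \<omega> = l}" for l
    proof (cases "length l = m")
      case True
      have iff: "map f [1..<Suc m] = l \<longleftrightarrow> (\<forall>i\<in>{1..m}. f i = l ! (i - 1))" for f
        unfolding map_nth_eq_iff using True by auto
      have "emeasure M' {\<omega> \<in> space M' - Z. ?F \<omega> = l} \<le>
          emeasure M' {\<omega> \<in> space M'. (\<forall>i\<in>{1..m}. X (k + i) \<omega> - X (k + i - 1) \<omega> = l ! (i - 1)) \<and>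
            (\<forall>j<m. X (k + j) \<omega> \<notin> A)}"
      proof (rule emeasure_mono)
        show "{\<omega> \<in> space M'. (\<forall>i\<in>{1..m}. X (k + i) \<omega> - X (k + i - 1) \<omega> = l ! (i - 1)) \<and>
            (\<forall>j<m. X (k + j) \<omega> \<notin> A)} \<in> M'.events"
          unfolding \<zeta>_def[symmetric] using \<zeta> by measurable
      qed (unfold iff, auto simp: Z_def \<zeta>_def)
      also have "\<dots> \<le> (\<Prod>i\<in>{1..m}. emeasure P {\<omega> \<in> space P. \<xi> \<omega> = l ! (i - 1)})"
        by (rule perturbed_walk_increments_le[OF P mc])
      also have "\<dots> = emeasure M {\<omega> \<in> space M. ?F' \<omega> = l}"
        unfolding M.emeasure_eq_measure P.emeasure_eq_measure iff
        using iid_cylinder[OF M P \<xi> ind eq, of m "\<lambda>i. {l ! (i - 1)}"]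
        by (simp add: prod_ennreal)
      finally show ?thesis .
    next
      case False
      then have "{\<omega> \<in> space M' - Z. ?F \<omega> = l} = {}" unfolding map_nth_eq_iff by auto
      then show ?thesis by (simp only: emeasure_empty zero_le)
    qed
    have "(\<integral>\<^sup>+\<omega>. ennreal (\<phi> m (?F \<omega>)) * indicator (space M' - Z) \<omega> \<partial>M') =
        (\<integral>\<^sup>+l. ennreal (\<phi> m l) * emeasure M' {\<omega> \<in> space M' - Z. ?F \<omega> = l} \<partial>count_space UNIV)"
      by (rule nn_integral_countable_fibres[OF ml(1) sets.compl_sets[OF Z]])
    also have "\<dots> \<le> (\<integral>\<^sup>+l. ennreal (\<phi> m l) * emeasure M {\<omega> \<in> space M. ?F' \<omega> = l} \<partial>count_space UNIV)"
      by (intro nn_integral_mono mult_left_mono law zero_le)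
    also have "\<dots> = (\<integral>\<^sup>+\<omega>. ennreal (\<phi> m (?F' \<omega>)) * indicator (space M) \<omega> \<partial>M)"
      by (rule nn_integral_countable_fibres[OF ml(2) sets.top, symmetric])
    also have "\<dots> = (\<integral>\<^sup>+\<omega>. \<phi> m (?F' \<omega>) \<partial>M)"
      by (intro nn_integral_cong) (simp del: upt_Suc)
    also have "\<dots> = ennreal (\<integral>\<omega>. \<Psi> (T m (\<lambda>i. \<xi>s i \<omega>)) \<partial>M)"
      unfolding \<Psi>T[symmetric]
      by (rule nn_integral_eq_integral[OF M.integrable_const_bound[where B = 1, OF AE_I2[OF bound] m\<Psi>T(2)] AE_I2[OF pos]])
    finally have off: "(\<integral>\<^sup>+\<omega>. ennreal (\<phi> m (?F \<omega>)) * indicator (space M' - Z) \<omega> \<partial>M') \<le>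
        ennreal (\<integral>\<omega>. \<Psi> (T m (\<lambda>i. \<xi>s i \<omega>)) \<partial>M)" .
    have "ennreal (\<integral>\<omega>. \<Psi> (T m (\<lambda>i. \<zeta> i \<omega>)) \<partial>M') = (\<integral>\<^sup>+\<omega>. \<phi> m (?F \<omega>) \<partial>M')"
      unfolding \<Psi>T[symmetric]
      by (rule nn_integral_eq_integral[symmetric, OF M'.integrable_const_bound[where B = 1, OF AE_I2[OF bound] m\<Psi>T(1)] AE_I2[OF pos]])
    \<comment> \<open>On \<open>Z\<close> the integrand is simply replaced by its upper bound
      1.\<close>
    also have "\<dots> \<le> (\<integral>\<^sup>+\<omega>. ennreal (\<phi> m (?F \<omega>)) * indicator (space M' - Z) \<omega> + indicator Z \<omega> \<partial>M')"
      by (intro nn_integral_mono) (auto simp: \<phi>_def le1 split: split_indicator simp del: upt_Suc)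
    also have "\<dots> = (\<integral>\<^sup>+\<omega>. ennreal (\<phi> m (?F \<omega>)) * indicator (space M' - Z) \<omega> \<partial>M') + emeasure M' Z"
    proof -
      have "(\<lambda>\<omega>. ennreal (\<phi> m (?F \<omega>))) \<in> borel_measurable M'"
        by (rule measurable_compose[OF ml(1)]) simp
      then have "(\<lambda>\<omega>. ennreal (\<phi> m (?F \<omega>)) * indicator (space M' - Z) \<omega>) \<in> borel_measurable M'"
        using Z by (intro borel_measurable_times_ennreal borel_measurable_indicator) auto
      from nn_integral_add[OF this, of "indicator Z"] Z show ?thesis by (simp del: upt_Suc)
    qed
    also have "\<dots> \<le> ennreal (\<integral>\<omega>. \<Psi> (T m (\<lambda>i. \<xi>s i \<omega>)) \<partial>M) + emeasure M' Z"
      by (rule add_right_mono[OF off])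
    finally have "ennreal (\<integral>\<omega>. \<Psi> (T m (\<lambda>i. \<zeta> i \<omega>)) \<partial>M') \<le>
        ennreal (\<integral>\<omega>. \<Psi> (T m (\<lambda>i. \<xi>s i \<omega>)) \<partial>M) + emeasure M' Z" .
    also have "\<dots> = ennreal ((\<integral>\<omega>. \<Psi> (T m (\<lambda>i. \<xi>s i \<omega>)) \<partial>M) + measure M' Z)"
      unfolding M'.emeasure_eq_measure using nonneg by (simp add: ennreal_plus)
    finally show ?thesis
      by (rule ennreal_le_iff[THEN iffD1, rotated]) (use nonneg in simp)
  qed
  have 1: "(\<lambda>m. \<integral>\<omega>. \<Psi> (T m (\<lambda>i. \<zeta> i \<omega>)) \<partial>M') \<longlonglongrightarrow> (\<integral>\<omega>. \<Psi> (\<lambda>i. \<zeta> i \<omega>) \<partial>M')"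
    by (rule integral_dominated_convergence[where w = "\<lambda>_. 1", OF m\<Psi>(1) m\<Psi>T(1)])
      (simp_all only: bound lim AE_I2 M'.integrable_const)
  have 2: "(\<lambda>m. \<integral>\<omega>. \<Psi> (T m (\<lambda>i. \<xi>s i \<omega>)) \<partial>M) \<longlonglongrightarrow> (\<integral>\<omega>. \<Psi> (\<lambda>i. \<xi>s i \<omega>) \<partial>M)"
    by (rule integral_dominated_convergence[where w = "\<lambda>_. 1", OF m\<Psi>(2) m\<Psi>T(2)])
      (simp_all only: bound lim AE_I2 M.integrable_const)
  have "(\<integral>\<omega>. \<Psi> (\<lambda>i. \<zeta> i \<omega>) \<partial>M') \<le> (\<integral>\<omega>. \<Psi> (\<lambda>i. \<xi>s i \<omega>) \<partial>M) + measure M' Z"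
    by (rule LIMSEQ_le[OF 1 tendsto_add[OF 2 tendsto_const]]) (use fin in blast)
  then show ?thesis unfolding \<zeta>_def Z_def .
qed

section \<open>Rescaled paths\<close>

lemma scaled_path_apply:
  "t \<ge> 0 \<Longrightarrow> scaled_path w n c t = vec_of_int (w (nat \<lfloor>real n * t\<rfloor>)) /\<^sub>R c"
  by (simp add: scaled_path_def)

lemma scaled_path_grid: "n > 0 \<Longrightarrow> scaled_path w n c (real i / real n) = vec_of_int (w i) /\<^sub>R c"
  by (simp add: scaled_path_apply)

lemma vec_of_int_diff: "vec_of_int (u - v) = vec_of_int u - vec_of_int v"
  by (simp add: vec_of_int_def vec_eq_iff)

lemma vec_of_int_add: "vec_of_int (u + v) = vec_of_int u + vec_of_int v"
  by (simp add: vec_of_int_def vec_eq_iff)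

lemma vec_of_int_0 [simp]: "vec_of_int 0 = 0"
  by (simp add: vec_of_int_def vec_eq_iff)

lemma vec_of_int_eq_0_iff [simp]: "vec_of_int v = 0 \<longleftrightarrow> v = 0"
  by (simp add: vec_of_int_def vec_eq_iff)

lemma scaled_path_in_skorokhod_space: "scaled_path w n c \<in> skorokhod_space"
  unfolding skorokhod_space_def
proof (intro CollectI conjI allI impI)
  show "scaled_path w n c \<in> extensional {0..}" by (simp add: scaled_path_def)
next
  fix t :: real assume t: "t \<ge> 0"
  have "\<exists>b>t. \<forall>s>t. s < b \<longrightarrow> \<lfloor>real n * s\<rfloor> = \<lfloor>real n * t\<rfloor>"
  proof (cases "n = 0")
    case False
    define b where "b = (of_int \<lfloor>real n * t\<rfloor> + 1) / real n"
    have "t < b" using False unfolding b_def by (simp add: pos_less_divide_eq mult.commute)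
    moreover have "\<lfloor>real n * s\<rfloor> = \<lfloor>real n * t\<rfloor>" if "t < s" "s < b" for s
    proof (rule floor_unique)
      have "real n * t \<le> real n * s" using that by (intro mult_left_mono) auto
      then show "of_int \<lfloor>real n * t\<rfloor> \<le> real n * s" by linarith
      show "real n * s < of_int \<lfloor>real n * t\<rfloor> + 1"
        using that(2) False unfolding b_def by (simp add: pos_less_divide_eq mult.commute)
    qed
    ultimately show ?thesis by blast
  qed (auto intro: exI[of _ "t + 1"])
  then have "\<forall>\<^sub>F s in at_right t. \<lfloor>real n * s\<rfloor> = \<lfloor>real n * t\<rfloor>"
    unfolding eventually_at_right_field by blast
  moreover have "\<forall>\<^sub>F s in at_right t. t < s" by (rule eventually_at_right_less)
  ultimately have "\<forall>\<^sub>F s in at_right t. scaled_path w n c s = scaled_path w n c t"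
    by eventually_elim (use t in \<open>simp add: scaled_path_apply\<close>)
  then show "(scaled_path w n c \<longlongrightarrow> scaled_path w n c t) (at_right t)"
    by (rule tendsto_eventually)
next
  fix t :: real assume t: "t > 0"
  \<comment> \<open>Just to the left of t the floor of n s is the ceiling of n t minus 1, which
    differs from the floor of n t exactly when n t is an integer.\<close>
  have "\<exists>b<t. \<forall>s>b. s < t \<longrightarrow> \<lfloor>real n * s\<rfloor> = \<lceil>real n * t\<rceil> - 1" if "n \<noteq> 0"
  proof -
    define b where "b = (of_int \<lceil>real n * t\<rceil> - 1) / real n"
    have "of_int \<lceil>real n * t\<rceil> - 1 < real n * t" by linarith
    then have "b < t" using that unfolding b_def by (simp add: pos_divide_less_eq mult.commute)
    moreover have "\<lfloor>real n * s\<rfloor> = \<lceil>real n * t\<rceil> - 1" if "b < s" "s < t" for s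
    proof (rule floor_unique)
      show "of_int (\<lceil>real n * t\<rceil> - 1) \<le> real n * s"
        using that(1) \<open>n \<noteq> 0\<close> unfolding b_def by (simp add: pos_divide_less_eq mult.commute less_imp_le)
      have "real n * s < real n * t" using that \<open>n \<noteq> 0\<close> by simp
      then show "real n * s < of_int (\<lceil>real n * t\<rceil> - 1) + 1" by simp linarith
    qed
    ultimately show ?thesis by blast
  qed
  moreover have "\<exists>b<t. \<forall>s>b. s < t \<longrightarrow> \<lfloor>real n * s\<rfloor> = 0" if "n = 0"
    using that by (auto intro: exI[of _ "t - 1"])
  ultimately obtain k where "\<exists>b<t. \<forall>s>b. s < t \<longrightarrow> \<lfloor>real n * s\<rfloor> = k" by blast
  then have "\<forall>\<^sub>F s in at_left t. \<lfloor>real n * s\<rfloor> = k"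
    unfolding eventually_at_left_field by blast
  moreover have "\<forall>\<^sub>F s in at_left t. s > 0"
    unfolding eventually_at_left_field using t by blast
  ultimately have "\<forall>\<^sub>F s in at_left t. scaled_path w n c s = vec_of_int (w (nat k)) /\<^sub>R c"
    by eventually_elim (simp add: scaled_path_apply)
  then show "\<exists>l. (scaled_path w n c \<longlongrightarrow> l) (at_left t)"
    using tendsto_eventually by blast
qed

text \<open>A basic neighbourhood compares paths only up to its horizon T, that is, through finitely
  many positions of the walk; if these agree, the identity serves as time change. Open sets of paths
  thus become accessible through finite histories.\<close>

lemma scaled_path_locally_determined:
  assumes U: "openin J1_topology U" and w: "scaled_path w n c \<in> U"
  obtains m where "\<And>w'. (\<forall>i\<le>m. w' i = w i) \<Longrightarrow> scaled_path w' n c \<in> U"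
proof -
  obtain T \<epsilon> where e: "\<epsilon> > 0" "J1_nbhd (scaled_path w n c) T \<epsilon> \<subseteq> U"
    using U w unfolding openin_J1_topology by blast
  have "scaled_path w' n c \<in> U" if w': "\<forall>i\<le>nat \<lfloor>real n * T\<rfloor>. w' i = w i" for w'
  proof -
    have "scaled_path w' n c t = scaled_path w n c t" if "t \<in> {0..T}" for t
    proof -
      have "real n * t \<le> real n * T" using that by (intro mult_left_mono) auto
      then have "nat \<lfloor>real n * t\<rfloor> \<le> nat \<lfloor>real n * T\<rfloor>" by (intro nat_mono floor_mono)
      then show ?thesis using w' that by (simp add: scaled_path_apply)
    qed
    then have "scaled_path w' n c \<in> J1_nbhd (scaled_path w n c) T \<epsilon>"
      unfolding J1_nbhd_def using e(1) id_time_changes scaled_path_in_skorokhod_space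
      by (auto intro!: bexI[of _ "\<lambda>t. t"])
    then show ?thesis using e(2) by blast
  qed
  then show thesis using that by blast
qed

section \<open>Borel measurability of rescaled paths\<close>

lemma sets_borel_of: "sets (borel_of T) = sigma_sets (topspace T) {U. openin T U}"
  unfolding borel_of_def by (rule sets_measure_of) (auto dest: openin_subset)

lemma space_borel_of [simp]: "space (borel_of T) = topspace T"
  unfolding borel_of_def by (rule space_measure_of) (auto dest: openin_subset)

lemma continuous_map_borel_of:
  assumes "continuous_map T euclideanreal f"
  shows "f \<in> borel_of T \<rightarrow>\<^sub>M borel"
proof (rule borel_measurableI)
  fix S :: "real set" assume "open S"
  then have "openin T {x \<in> topspace T. f x \<in> S}"
    using openin_continuous_map_preimage[OF assms] by simp
  then show "f -` S \<inter> space (borel_of T) \<in> sets (borel_of T)"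
    unfolding sets_borel_of by (intro sigma_sets.Basic) (simp add: vimage_def Int_def conj_commute)
qed

text \<open>The preimage of an open set is the union of the events given by those finite histories
  that force the path into it, and there are only countably many finite histories.\<close>

lemma scaled_path_measurable:
  fixes X :: "nat \<Rightarrow> 'w \<Rightarrow> int ^ 'd"
  assumes X: "\<And>k. X k \<in> M \<rightarrow>\<^sub>M count_space UNIV"
  shows "(\<lambda>\<omega>. scaled_path (\<lambda>k. X k \<omega>) n c) \<in> M \<rightarrow>\<^sub>M borel_of J1_topology"
  unfolding borel_of_def
proof (rule measurable_measure_of)
  show "{U. openin J1_topology U} \<subseteq> Pow (topspace J1_topology)" by (auto dest: openin_subset)
  show "(\<lambda>\<omega>. scaled_path (\<lambda>k. X k \<omega>) n c) \<in> space M \<rightarrow> topspace J1_topology"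
    by (simp add: topspace_J1_topology scaled_path_in_skorokhod_space)
next
  fix U :: "(real \<Rightarrow> real ^ 'd) set" assume "U \<in> {U. openin J1_topology U}"
  then have U: "openin J1_topology U" by simp
  define C where "C = {l. \<forall>w. map w [0..<length l] = l \<longrightarrow> scaled_path w n c \<in> U}"
  have ex: "\<exists>l\<in>C. map w [0..<length l] = l" if w: "scaled_path w n c \<in> U" for w
  proof -
    obtain m where m: "\<And>w'. (\<forall>i\<le>m. w' i = w i) \<Longrightarrow> scaled_path w' n c \<in> U"
      using scaled_path_locally_determined[OF U w] by blast
    have "map w [0..<Suc m] \<in> C"
      unfolding C_def
    proof (intro CollectI allI impI)
      fix w' assume w': "map w' [0..<length (map w [0..<Suc m])] = map w [0..<Suc m]"
      show "scaled_path w' n c \<in> U"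
        by (rule m) (use w' in \<open>auto simp: map_nth_eq_iff simp del: upt_Suc\<close>)
    qed
    then show ?thesis by (intro bexI[of _ "map w [0..<Suc m]"]) (simp_all del: upt_Suc)
  qed
  have eq: "(\<lambda>\<omega>. scaled_path (\<lambda>k. X k \<omega>) n c) -` U \<inter> space M =
      (\<Union>l\<in>C. (\<lambda>\<omega>. map (\<lambda>k. X k \<omega>) [0..<length l]) -` {l} \<inter> space M)" (is "?L = ?R")
  proof (intro subset_antisym subsetI)
    fix \<omega> assume "\<omega> \<in> ?L"
    then show "\<omega> \<in> ?R" using ex[of "\<lambda>k. X k \<omega>"] by auto
  next
    fix \<omega> assume "\<omega> \<in> ?R"
    then show "\<omega> \<in> ?L" by (auto simp: C_def)
  qed
  have "(\<lambda>\<omega>. map (\<lambda>k. X k \<omega>) [0..<length l]) -` {l} \<inter> space M \<in> sets M" for l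
    by (rule measurable_sets[OF measurable_map_count_space[OF X]]) simp
  then show "(\<lambda>\<omega>. scaled_path (\<lambda>k. X k \<omega>) n c) -` U \<inter> space M \<in> sets M"
    unfolding eq by (intro sets.countable_UN' countableI_type) blast
qed

text \<open>Setting the steps after m to 0 leaves the positions up to m unchanged, so eventually it
  does not lead out of the open preimage of a neighbourhood. This is the limit property required of
  the functional in \<open>perturbed_walk_compare\<close>.\<close>

lemma scaled_path_truncation_tendsto:
  fixes z :: "nat \<Rightarrow> int ^ 'd"
  assumes g: "continuous_map J1_topology euclideanreal g"
  shows "(\<lambda>m. g (scaled_path (\<lambda>j. \<Sum>i=1..j. if i \<in> {1..m} then z i else 0) n c))
    \<longlonglongrightarrow> g (scaled_path (\<lambda>j. \<Sum>i=1..j. z i) n c)"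
proof (rule topological_tendstoI)
  fix V :: "real set" assume V: "open V" "g (scaled_path (\<lambda>j. \<Sum>i=1..j. z i) n c) \<in> V"
  let ?U = "{x \<in> topspace J1_topology. g x \<in> V}"
  have U: "openin J1_topology ?U" using openin_continuous_map_preimage[OF g] V(1) by simp
  have "scaled_path (\<lambda>j. \<Sum>i=1..j. z i) n c \<in> ?U"
    using V(2) by (simp add: topspace_J1_topology scaled_path_in_skorokhod_space)
  from scaled_path_locally_determined[OF U this] obtain m0
    where m0: "\<And>w'. (\<forall>j\<le>m0. w' j = (\<Sum>i=1..j. z i)) \<Longrightarrow> scaled_path w' n c \<in> ?U" by blast
  show "\<forall>\<^sub>F m in sequentially.
      g (scaled_path (\<lambda>j. \<Sum>i=1..j. if i \<in> {1..m} then z i else 0) n c) \<in> V"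
    using eventually_ge_at_top[of m0]
  proof eventually_elim
    case (elim m)
    have "scaled_path (\<lambda>j. \<Sum>i=1..j. if i \<in> {1..m} then z i else 0) n c \<in> ?U"
      by (rule m0) (use elim in \<open>auto intro!: sum.cong\<close>)
    then show ?case by simp
  qed
qed

section \<open>Effect of deleting the first k steps\<close>

text \<open>
  The time change \<open>t \<mapsto> t + k min(t, 1/n)\<close> squeezes the first \<open>k\<close> steps of \<open>w\<close> into the interval
  \<open>[0, 1/n)\<close>, on which the shifted path vanishes.
\<close>

lemma squeeze_time_change:
  assumes b: "b > 0" and K: "K \<ge> 0"
  shows "(\<lambda>t. t + K * min t b) \<in> time_changes"
proof -
  let ?\<tau> = "\<lambda>t. t + K * min t b"
  have "?\<tau> s < ?\<tau> t" if "s < t" for s t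
    using that K mult_left_mono[of "min s b" "min t b" K] by linarith
  then have "strict_mono_on {0..} ?\<tau>" by (auto simp: strict_mono_on_def)
  moreover have "s \<in> ?\<tau> ` {0..}" if s: "s \<ge> 0" for s
  proof (cases "s \<le> b + K * b")
    case True
    have "s / (1 + K) \<le> b" using True K by (simp add: pos_divide_le_eq algebra_simps)
    then have "?\<tau> (s / (1 + K)) = s / (1 + K) + K * (s / (1 + K))" by (simp only: min_absorb1)
    also have "\<dots> = (1 + K) * (s / (1 + K))" by (simp only: distrib_right mult_1_left)
    also have "\<dots> = s" using K by simp
    finally show ?thesis using s K by (intro image_eqI[of _ _ "s / (1 + K)"]) auto
  next
    case False
    then show ?thesis using b by (intro image_eqI[of _ _ "s - K * b"]) auto
  qed
  moreover have "?\<tau> t \<ge> 0" if "t \<ge> 0" for t using that b K by simp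
  ultimately show ?thesis unfolding time_changes_def by auto
qed

text \<open>Before time 1 / n the shifted path is 0 and the squeezed one runs through w 0, ..., w k,
  all of norm at most B / c after scaling. From 1 / n on the time change is the translation by k /
  n, and the paths differ by w k / c throughout. The estimates hold at all times, hence for the
  horizon 1 / \<epsilon>.\<close>

lemma J1_gauge_scaled_path_shift:
  fixes w :: "nat \<Rightarrow> int ^ 'd"
  assumes n: "n > 0" and c: "c > 0"
    and B: "\<And>j. j \<le> k \<Longrightarrow> norm (vec_of_int (w j)) \<le> B"
    and \<epsilon>: "real k / real n < \<epsilon>" "B / c < \<epsilon>"
  shows "J1_gauge (scaled_path (\<lambda>j. w (k + j) - w k) n c) (scaled_path w n c) \<le> \<epsilon>"
proof (rule J1_gauge_le)
  have B0: "0 \<le> B" using B[of 0] norm_ge_zero[of "vec_of_int (w 0)"] by linarith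
  then show pos: "\<epsilon> > 0" using \<epsilon>(2) c by (meson divide_nonneg_pos le_less_trans)
  define \<tau> where "\<tau> t = t + real k * min t (1 / real n)" for t
  have \<tau>: "\<tau> \<in> time_changes"
    unfolding \<tau>_def using squeeze_time_change[of "1 / real n" "real k"] n by simp
  have near: "\<bar>\<tau> t - t\<bar> < \<epsilon>" if "t \<ge> 0" for t
  proof -
    have "\<bar>\<tau> t - t\<bar> = real k * min t (1 / real n)" using that by (simp add: \<tau>_def)
    also have "\<dots> \<le> real k * (1 / real n)" by (intro mult_left_mono) auto
    finally show ?thesis using \<epsilon>(1) by simp
  qed
  have small: "norm (vec_of_int (w j) /\<^sub>R c) < \<epsilon>" if "j \<le> k" for j
  proof -
    have "norm (vec_of_int (w j) /\<^sub>R c) = norm (vec_of_int (w j)) / c"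
      using c by (simp add: divide_inverse mult.commute)
    also have "\<dots> \<le> B / c" using B[OF that] c by (intro divide_right_mono) auto
    finally show ?thesis using \<epsilon>(2) by simp
  qed
  have "dist (scaled_path w n c (\<tau> t)) (scaled_path (\<lambda>j. w (k + j) - w k) n c t) < \<epsilon>"
    if t: "t \<ge> 0" for t
  proof (cases "t < 1 / real n")
    case True
    then have nt: "real n * t < 1" using n by (simp add: pos_less_divide_eq mult.commute)
    have "real n * \<tau> t = (real k + 1) * (real n * t)"
      using True by (simp add: \<tau>_def algebra_simps)
    also have "\<dots> < (real k + 1) * 1" using nt by (intro mult_strict_left_mono) auto
    finally have "\<lfloor>real n * \<tau> t\<rfloor> \<le> int k" by (simp add: floor_le_iff)
    then have "nat \<lfloor>real n * \<tau> t\<rfloor> \<le> k" by simp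
    moreover have "\<lfloor>real n * t\<rfloor> = 0" using nt t by (intro floor_unique) auto
    moreover have "\<tau> t \<ge> 0" using t by (simp add: \<tau>_def)
    ultimately show ?thesis using t small by (simp add: scaled_path_apply)
  next
    case False
    then have "real n * \<tau> t = real n * t + real k" using n by (simp add: \<tau>_def algebra_simps)
    then have "\<lfloor>real n * \<tau> t\<rfloor> = \<lfloor>real n * t\<rfloor> + int k"
      by (metis floor_add_int of_int_of_nat_eq)
    then have "nat \<lfloor>real n * \<tau> t\<rfloor> = k + nat \<lfloor>real n * t\<rfloor>" using t by (simp add: nat_add_distrib)
    moreover have "\<tau> t \<ge> 0" using t by (simp add: \<tau>_def)
    ultimately show ?thesis
      using t small[of k] by (simp add: scaled_path_apply vec_of_int_diff dist_norm scaleR_diff_right)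
  qed
  then show "scaled_path w n c \<in> J1_nbhd (scaled_path (\<lambda>j. w (k + j) - w k) n c) (1 / \<epsilon>) \<epsilon>"
    unfolding J1_nbhd_def using \<tau> near scaled_path_in_skorokhod_space
    by (auto intro!: bexI[of _ \<tau>])
qed

section \<open>Convergence in distribution\<close>

text \<open>Envelopes lie below \<open>f\<close>, so the lower limit of the integrals of f (Y n) is
  at least the integral of any envelope at Z, and these tend to the integral of f (Z) by dominated
  convergence under the single law of Z. Replacing \<open>f\<close> by 1 - f bounds the upper limit,
  and an affine map carries bounded functions into [0,1].\<close>

lemma J1_converges_in_distributionI:
  fixes Y :: "nat \<Rightarrow> 'w \<Rightarrow> real \<Rightarrow> 'a::metric_space"
  assumes M: "\<And>n. prob_space (M n)" and Y: "\<And>n. Y n \<in> M n \<rightarrow>\<^sub>M borel_of J1_topology"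
    and N: "prob_space N" and Z: "Z \<in> N \<rightarrow>\<^sub>M borel_of J1_topology"
    and Lip: "\<And>g L. \<lbrakk>\<And>x. x \<in> skorokhod_space \<Longrightarrow> g x \<in> {0..1};
        \<And>x y. x \<in> skorokhod_space \<Longrightarrow> y \<in> skorokhod_space \<Longrightarrow> \<bar>g x - g y\<bar> \<le> L * J1_gauge x y\<rbrakk>
      \<Longrightarrow> (\<lambda>n. \<integral>\<omega>. g (Y n \<omega>) \<partial>M n) \<longlonglongrightarrow> (\<integral>\<omega>. g (Z \<omega>) \<partial>N)"
  shows "converges_in_distribution J1_topology M Y N Z"
proof -
  interpret M: prob_space "M n" for n by (rule M)
  interpret N: prob_space N by (rule N)
  have YD: "Y n \<omega> \<in> skorokhod_space" if "\<omega> \<in> space (M n)" for n \<omega>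
    using measurable_space[OF Y that] by (simp add: topspace_J1_topology)
  have ZD: "Z \<omega> \<in> skorokhod_space" if "\<omega> \<in> space N" for \<omega>
    using measurable_space[OF Z that] by (simp add: topspace_J1_topology)
  have intY: "integrable (M n) (\<lambda>\<omega>. f (Y n \<omega>))"
    if "continuous_map J1_topology euclideanreal f" "\<And>x. x \<in> skorokhod_space \<Longrightarrow> \<bar>f x\<bar> \<le> b" for f b n
    by (rule M.integrable_const_bound[where B = b])
      (use that YD measurable_compose[OF Y continuous_map_borel_of] in auto)
  have mZ: "(\<lambda>\<omega>. f (Z \<omega>)) \<in> borel_measurable N"
    if "continuous_map J1_topology euclideanreal f" for f
    by (rule measurable_compose[OF Z continuous_map_borel_of[OF that]])
  have intZ: "integrable N (\<lambda>\<omega>. f (Z \<omega>))"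
    if "continuous_map J1_topology euclideanreal f" "\<And>x. x \<in> skorokhod_space \<Longrightarrow> \<bar>f x\<bar> \<le> b" for f b
    by (rule N.integrable_const_bound[where B = b]) (use that ZD mZ in auto)
  have lower: "\<forall>\<^sub>F n in sequentially. (\<integral>\<omega>. f (Y n \<omega>) \<partial>M n) > (\<integral>\<omega>. f (Z \<omega>) \<partial>N) - e"
    if f: "continuous_map J1_topology euclideanreal f"
      and f01: "\<And>x. x \<in> skorokhod_space \<Longrightarrow> f x \<in> {0..1}" and e: "e > 0" for f e
  proof -
    let ?g = "\<lambda>m. J1_envelope f (real m)"
    have g01: "?g m x \<in> {0..1}" if "x \<in> skorokhod_space" for m x
      by (rule J1_envelope_01[OF f01 of_nat_0_le_iff that])
    have g: "continuous_map J1_topology euclideanreal (?g m)" for m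
      by (rule J1_envelope_continuous_map[OF f01 of_nat_0_le_iff])
    have gabs: "\<bar>?g m x\<bar> \<le> 1" if "x \<in> skorokhod_space" for m x
      using g01[OF that, of m] by simp
    have "(\<lambda>m. \<integral>\<omega>. ?g m (Z \<omega>) \<partial>N) \<longlonglongrightarrow> (\<integral>\<omega>. f (Z \<omega>) \<partial>N)"
    proof (rule integral_dominated_convergence[where w = "\<lambda>_. 1"])
      show "AE \<omega> in N. (\<lambda>m. ?g m (Z \<omega>)) \<longlonglongrightarrow> f (Z \<omega>)"
        using J1_envelope_tendsto[OF f01 f] ZD by simp
      show "AE \<omega> in N. norm (?g m (Z \<omega>)) \<le> 1" for m
        using g01 ZD by (intro AE_I2) fastforce
    qed (use mZ[OF f] mZ[OF g] in auto)
    then have "\<forall>\<^sub>F m in sequentially. (\<integral>\<omega>. ?g m (Z \<omega>) \<partial>N) > (\<integral>\<omega>. f (Z \<omega>) \<partial>N) - e"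
      using e by (intro order_tendstoD) auto
    then obtain m where m: "(\<integral>\<omega>. ?g m (Z \<omega>) \<partial>N) > (\<integral>\<omega>. f (Z \<omega>) \<partial>N) - e"
      using eventually_happens'[OF sequentially_bot] by blast
    have "(\<lambda>n. \<integral>\<omega>. ?g m (Y n \<omega>) \<partial>M n) \<longlonglongrightarrow> (\<integral>\<omega>. ?g m (Z \<omega>) \<partial>N)"
      by (rule Lip[OF g01 J1_envelope_Lipschitz[of f, OF f01 of_nat_0_le_iff]])
    then have "\<forall>\<^sub>F n in sequentially. (\<integral>\<omega>. ?g m (Y n \<omega>) \<partial>M n) > (\<integral>\<omega>. f (Z \<omega>) \<partial>N) - e"
      using m by (rule order_tendstoD)
    then show ?thesis
    proof eventually_elim
      case (elim n)
      have "(\<integral>\<omega>. ?g m (Y n \<omega>) \<partial>M n) \<le> (\<integral>\<omega>. f (Y n \<omega>) \<partial>M n)"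
      proof (rule integral_mono)
        show "integrable (M n) (\<lambda>\<omega>. ?g m (Y n \<omega>))" by (rule intY[of _ 1, OF g gabs])
        show "integrable (M n) (\<lambda>\<omega>. f (Y n \<omega>))" by (rule intY[of _ 1, OF f]) (use f01 in fastforce)
      qed (use J1_envelope_le[of f, OF f01 of_nat_0_le_iff] YD in auto)
      then show ?case using elim by simp
    qed
  qed
  have unit: "(\<lambda>n. \<integral>\<omega>. f (Y n \<omega>) \<partial>M n) \<longlonglongrightarrow> (\<integral>\<omega>. f (Z \<omega>) \<partial>N)"
    if f: "continuous_map J1_topology euclideanreal f"
      and f01: "\<And>x. x \<in> skorokhod_space \<Longrightarrow> f x \<in> {0..1}" for f
  proof (rule LIMSEQ_I)
    fix e :: real assume e: "e > 0"
    have f': "continuous_map J1_topology euclideanreal (\<lambda>x. 1 - f x)"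
      using f by (intro continuous_intros) auto
    have 1: "(\<integral>\<omega>. 1 - f (Y n \<omega>) \<partial>M n) = 1 - (\<integral>\<omega>. f (Y n \<omega>) \<partial>M n)" for n
      using intY[of _ 1, OF f] f01 by (subst Bochner_Integration.integral_diff) (fastforce simp: M.prob_space)+
    have 2: "(\<integral>\<omega>. 1 - f (Z \<omega>) \<partial>N) = 1 - (\<integral>\<omega>. f (Z \<omega>) \<partial>N)"
      using intZ[of _ 1, OF f] f01 by (subst Bochner_Integration.integral_diff) (fastforce simp: N.prob_space)+
    have "\<forall>\<^sub>F n in sequentially. (\<integral>\<omega>. 1 - f (Y n \<omega>) \<partial>M n) > (\<integral>\<omega>. 1 - f (Z \<omega>) \<partial>N) - e"
      by (rule lower[OF f' _ e]) (use f01 in fastforce)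
    moreover have "\<forall>\<^sub>F n in sequentially. (\<integral>\<omega>. f (Y n \<omega>) \<partial>M n) > (\<integral>\<omega>. f (Z \<omega>) \<partial>N) - e"
      by (rule lower[OF f f01 e])
    ultimately have "\<forall>\<^sub>F n in sequentially. norm ((\<integral>\<omega>. f (Y n \<omega>) \<partial>M n) - (\<integral>\<omega>. f (Z \<omega>) \<partial>N)) < e"
      unfolding 1 2 by eventually_elim auto
    then show "\<exists>n0. \<forall>n\<ge>n0. norm ((\<integral>\<omega>. f (Y n \<omega>) \<partial>M n) - (\<integral>\<omega>. f (Z \<omega>) \<partial>N)) < e"
      by (simp add: eventually_sequentially)
  qed
  have "(\<lambda>n. \<integral>\<omega>. f (Y n \<omega>) \<partial>M n) \<longlonglongrightarrow> (\<integral>\<omega>. f (Z \<omega>) \<partial>N)"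
    if f: "continuous_map J1_topology euclideanreal f" and b: "bounded (f ` skorokhod_space)" for f
  proof -
    obtain b where b: "b > 0" "\<And>x. x \<in> skorokhod_space \<Longrightarrow> \<bar>f x\<bar> \<le> b"
      using b unfolding bounded_pos by auto
    define h where "h x = (f x + b) / (2 * b)" for x
    have h: "continuous_map J1_topology euclideanreal h"
      unfolding h_def using f b(1) by (intro continuous_intros) auto
    have h01: "h x \<in> {0..1}" if "x \<in> skorokhod_space" for x
      using b(2)[OF that] b(1) by (auto simp: h_def field_simps abs_le_iff)
    have fh: "f x = 2 * b * h x - b" for x using b(1) by (simp add: h_def)
    have 1: "(\<integral>\<omega>. f (Y n \<omega>) \<partial>M n) = 2 * b * (\<integral>\<omega>. h (Y n \<omega>) \<partial>M n) - b" for n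
      unfolding fh using intY[of _ 1, OF h] h01
      by (subst Bochner_Integration.integral_diff) (fastforce simp: M.prob_space)+
    have 2: "(\<integral>\<omega>. f (Z \<omega>) \<partial>N) = 2 * b * (\<integral>\<omega>. h (Z \<omega>) \<partial>N) - b"
      unfolding fh using intZ[of _ 1, OF h] h01
      by (subst Bochner_Integration.integral_diff) (fastforce simp: N.prob_space)+
    show ?thesis unfolding 1 2 by (intro tendsto_intros unit h h01)
  qed
  then show ?thesis
    unfolding converges_in_distribution_def using M N Y Z by (simp add: topspace_J1_topology)
qed

section \<open>Divergence of the norming sequence\<close>

text \<open>Detects a jump of size more than \<open>3\<eta>\<close> before time \<open>b\<close>.\<close>

lemma J1_envelope_oscillation:
  fixes x :: "real \<Rightarrow> 'a::metric_space"
  assumes x: "x \<in> skorokhod_space" and \<eta>: "\<eta> > 0" and b: "0 < b" "b \<le> 1"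
    and s: "s \<in> {0..b}" and t: "t \<in> {0..b}" and jump: "3 * \<eta> < dist (x s) (x t)"
  shows "1 \<le> J1_envelope
    (\<lambda>y. if \<forall>s\<in>{0..2 * b}. \<forall>t\<in>{0..2 * b}. dist (y s) (y t) \<le> \<eta> then 0 else 1) (1 / min \<eta> b) x"
proof (rule J1_envelope_greatest)
  \<comment> \<open>A gauge below this value yields a time change mapping [0, b] into [0, 2 b] with
    an error below \<eta> at both points; together with the oscillation \<eta> of y this allows x a
    jump of at most 3 \<eta>. A larger gauge is charged at least 1 by the slope 1 / min \<eta>
    b.\<close>
  let ?\<delta> = "min \<eta> b"
  have d: "?\<delta> > 0" using \<eta> b by simp
  fix y assume "y \<in> (skorokhod_space :: (real \<Rightarrow> 'a) set)"
  have "?\<delta> \<le> J1_gauge x y" if y: "\<forall>s\<in>{0..2 * b}. \<forall>t\<in>{0..2 * b}. dist (y s) (y t) \<le> \<eta>"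
  proof (rule ccontr)
    assume "\<not> ?thesis"
    then have "y \<in> J1_nbhd x (1 / ?\<delta>) ?\<delta>" using b by (intro J1_gauge_less_imp_nbhd) auto
    then obtain \<tau> where \<tau>: "\<tau> \<in> time_changes" "\<And>r. r \<ge> 0 \<Longrightarrow> \<bar>\<tau> r - r\<bar> < ?\<delta>"
        "\<And>r. r \<in> {0..1 / ?\<delta>} \<Longrightarrow> dist (y (\<tau> r)) (x r) < ?\<delta>"
      by (auto simp: J1_nbhd_def)
    have "?\<delta> \<le> 1" using b by simp
    then have "1 \<le> 1 / ?\<delta>" using d by (simp only: pos_le_divide_eq mult_1_left)
    then have near: "dist (y (\<tau> r)) (x r) < \<eta>" if "r \<in> {0..b}" for r
    proof -
      have "r \<in> {0..1 / ?\<delta>}" using \<open>1 \<le> 1 / ?\<delta>\<close> that b(2) unfolding atLeastAtMost_iff by linarith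
      from \<tau>(3)[OF this] show ?thesis by simp
    qed
    have "\<tau> r \<in> {0..2 * b}" if "r \<in> {0..b}" for r
    proof -
      have "\<tau> r \<ge> 0" using \<tau>(1) that by (auto simp: time_changes_def)
      then show ?thesis using \<tau>(2)[of r] that by auto
    qed
    then have "dist (y (\<tau> s)) (y (\<tau> t)) \<le> \<eta>" using y s t by blast
    then show False
      using near[OF s] near[OF t] jump dist_triangle[of "x s" "x t" "y (\<tau> s)"]
        dist_triangle[of "y (\<tau> s)" "x t" "y (\<tau> t)"] by (simp add: dist_commute)
  qed
  then show "1 \<le> (if \<forall>s\<in>{0..2 * b}. \<forall>t\<in>{0..2 * b}. dist (y s) (y t) \<le> \<eta> then 0 else 1) +
      1 / ?\<delta> * J1_gauge x y"
    using d J1_gauge_nonneg[of x y] by (auto simp: pos_le_divide_eq)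
qed (use \<eta> b x in auto)

lemma skorokhod_space_oscillation:
  fixes x :: "real \<Rightarrow> 'a::metric_space"
  assumes x: "x \<in> skorokhod_space" and \<eta>: "\<eta> > 0"
  shows "\<exists>b>0. \<forall>s\<in>{0..b}. \<forall>t\<in>{0..b}. dist (x s) (x t) \<le> \<eta>"
proof -
  have "(x \<longlongrightarrow> x 0) (at_right 0)" using x by (simp add: skorokhod_space_def)
  then have "\<forall>\<^sub>F s in at_right 0. dist (x s) (x 0) < \<eta> / 2" using \<eta> by (intro tendstoD) auto
  then obtain b where b: "b > 0" "\<And>s. 0 < s \<Longrightarrow> s < b \<Longrightarrow> dist (x s) (x 0) < \<eta> / 2"
    unfolding eventually_at_right_field by blast
  then have near: "dist (x s) (x 0) < \<eta> / 2" if "s \<in> {0..b / 2}" for s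
    using that \<eta> by (cases "s = 0") auto
  have "dist (x s) (x t) \<le> \<eta>" if "s \<in> {0..b / 2}" "t \<in> {0..b / 2}" for s t
    using near[OF that(1)] near[OF that(2)] dist_triangle2[of "x s" "x t" "x 0"] by simp
  then show ?thesis using b(1) by (intro exI[of _ "b / 2"]) auto
qed

text \<open>
  If \<open>a\<close> stayed bounded along a subsequence, a fixed nonzero value \<open>v\<close> of the steps would produce
  jumps of size bounded away from 0 at arbitrarily small times, contradicting right-continuity
  of the limit at 0.
\<close>

lemma norming_sequence_at_top:
  fixes \<xi> :: "'p \<Rightarrow> int ^ 'd" and \<xi>s :: "nat \<Rightarrow> 'm \<Rightarrow> int ^ 'd"
  assumes M: "prob_space M" and P: "prob_space P"
    and \<xi>: "\<xi> \<in> P \<rightarrow>\<^sub>M count_space UNIV"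
    and ind: "prob_space.indep_vars M (\<lambda>_. count_space UNIV) \<xi>s {1..}"
    and eq: "\<And>i. i \<ge> 1 \<Longrightarrow> distr M (count_space UNIV) (\<xi>s i) = distr P (count_space UNIV) \<xi>"
    and a: "\<And>n. n \<ge> 1 \<Longrightarrow> a n > 0"
    and nondegenerate: "\<not> (AE \<omega> in P. \<xi> \<omega> = 0)"
    and conv: "converges_in_distribution J1_topology
      (\<lambda>_. M) (\<lambda>n \<omega>. scaled_path (\<lambda>k. random_walk \<xi>s k \<omega>) n (a n)) N Z"
  shows "filterlim a at_top sequentially"
proof (rule ccontr)
  assume "\<not> ?thesis"
  then obtain C0 where C0: "\<not> (\<forall>\<^sub>F n in sequentially. C0 \<le> a n)" unfolding filterlim_at_top by blast
  \<comment> \<open>Failure of divergence gives a n < C for infinitely many n; the maximum with 1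
    makes C positive.\<close>
  define C where "C = max C0 1"
  have C: "C > 0" by (simp add: C_def)
  have freq: "\<exists>\<^sub>F n in sequentially. a n < C"
    unfolding frequently_def
  proof
    assume "\<forall>\<^sub>F n in sequentially. \<not> a n < C"
    then have "\<forall>\<^sub>F n in sequentially. C0 \<le> a n" by eventually_elim (simp add: C_def)
    then show False using C0 by blast
  qed
  interpret M: prob_space M by (rule M)
  interpret P: prob_space P by (rule P)
  let ?Y = "\<lambda>n \<omega>. scaled_path (\<lambda>k. random_walk \<xi>s k \<omega>) n (a n)"
  have N: "prob_space N" and Z: "Z \<in> N \<rightarrow>\<^sub>M borel_of J1_topology"
    and Y: "?Y n \<in> M \<rightarrow>\<^sub>M borel_of J1_topology" for n
    using conv unfolding converges_in_distribution_def by blast+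
  interpret N: prob_space N by (rule N)
  have ZD: "Z \<omega> \<in> skorokhod_space" if "\<omega> \<in> space N" for \<omega>
    using measurable_space[OF Z that] by (simp add: topspace_J1_topology)
  have "\<exists>v. v \<noteq> 0 \<and> P.prob {\<omega> \<in> space P. \<xi> \<omega> = v} \<noteq> 0"
  proof (rule ccontr)
    assume "\<not> ?thesis"
    then have *: "P.prob {\<omega> \<in> space P. \<xi> \<omega> = v} = 0" if "v \<noteq> 0" for v using that by blast
    have "AE \<omega> in P. \<forall>v. v \<noteq> 0 \<longrightarrow> \<xi> \<omega> \<noteq> v"
      unfolding AE_all_countable
    proof
      fix v :: "int ^ 'd"
      have "{\<omega> \<in> space P. \<xi> \<omega> = v} = \<xi> -` {v} \<inter> space P" by auto
      then have "{\<omega> \<in> space P. \<xi> \<omega> = v} \<in> P.events" using \<xi> by simp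
      then show "AE \<omega> in P. v \<noteq> 0 \<longrightarrow> \<xi> \<omega> \<noteq> v"
        using * P.prob_eq_0[of "{\<omega> \<in> space P. \<xi> \<omega> = v}"] by (cases "v = 0") auto
    qed
    then have "AE \<omega> in P. \<xi> \<omega> = 0" by eventually_elim blast
    then show False using nondegenerate by blast
  qed
  then obtain v where v: "v \<noteq> 0" "P.prob {\<omega> \<in> space P. \<xi> \<omega> = v} \<noteq> 0" by blast
  define q where "q = 1 - P.prob {\<omega> \<in> space P. \<xi> \<omega> = v}"
  have q: "0 \<le> q" "q < 1" using v(2) measure_nonneg[of P] P.prob_le_1 by (auto simp: q_def less_le)
  \<comment> \<open>For a n < C a step v is a jump of size at least |v| / C = 4 \<eta>, above the
    detection threshold 3 \<eta>.\<close>
  define \<eta> where "\<eta> = norm (vec_of_int v) / (4 * C)"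
  have \<eta>: "\<eta> > 0" using v(1) C by (simp add: \<eta>_def)
  \<comment> \<open>The window [0, 2 b K] = [0, 1 / (K + 1)] shrinks to 0, and b K \<le> 1 as the
    detection of jumps demands.\<close>
  define b where "b K = 1 / (2 * real (Suc K))" for K
  have b: "0 < b K" "b K \<le> 1" for K by (auto simp: b_def field_simps)
  define f where "f K = (\<lambda>y :: real \<Rightarrow> real ^ 'd.
    if \<forall>s\<in>{0..2 * b K}. \<forall>t\<in>{0..2 * b K}. dist (y s) (y t) \<le> \<eta> then 0 else 1 :: real)" for K
  define g where "g K = J1_envelope (f K) (1 / min \<eta> (b K))" for K
  have f01: "f K x \<in> {0..1}" for K x by (simp add: f_def)
  have L: "0 \<le> 1 / min \<eta> (b K)" for K using \<eta> b[of K] by simp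
  have g: "continuous_map J1_topology euclideanreal (g K)" for K
    unfolding g_def by (rule J1_envelope_continuous_map[OF f01 L])
  have g01: "g K x \<in> {0..1}" if "x \<in> skorokhod_space" for K x
    unfolding g_def by (rule J1_envelope_01[OF f01 L that])
  have g0: "(\<lambda>K. g K x) \<longlonglongrightarrow> 0" if x: "x \<in> skorokhod_space" for x
  proof -
    obtain c where c: "c > 0" "\<forall>s\<in>{0..c}. \<forall>t\<in>{0..c}. dist (x s) (x t) \<le> \<eta>"
      using skorokhod_space_oscillation[OF x \<eta>] by blast
    have "(\<lambda>K. inverse (real (Suc K))) \<longlonglongrightarrow> 0" by (rule LIMSEQ_inverse_real_of_nat)
    then have "\<forall>\<^sub>F K in sequentially. inverse (real (Suc K)) < c" using c(1) by (rule order_tendstoD)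
    then have "\<forall>\<^sub>F K in sequentially. g K x = 0"
    proof eventually_elim
      case (elim K)
      then have "2 * b K \<le> c" by (simp add: b_def inverse_eq_divide del: of_nat_Suc)
      then have "f K x = 0" using c(2) by (auto simp: f_def)
      then show ?case
        using J1_envelope_le[of "f K", OF f01 L[of K] x] g01[OF x, of K] unfolding g_def
        by (intro antisym) auto
    qed
    then show ?thesis by (rule tendsto_eventually)
  qed
  have "(\<lambda>K. \<integral>\<omega>. g K (Z \<omega>) \<partial>N) \<longlonglongrightarrow> (\<integral>\<omega>. 0 \<partial>N)"
  proof (rule integral_dominated_convergence[where w = "\<lambda>_. 1"])
    show "AE \<omega> in N. (\<lambda>K. g K (Z \<omega>)) \<longlonglongrightarrow> 0" using g0 ZD by simp
    show "AE \<omega> in N. norm (g K (Z \<omega>)) \<le> 1" for K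
      using g01 ZD by (intro AE_I2) fastforce
    show "(\<lambda>\<omega>. g K (Z \<omega>)) \<in> borel_measurable N" for K
      by (rule measurable_compose[OF Z continuous_map_borel_of[OF g]])
  qed auto
  then have "\<forall>\<^sub>F K in sequentially. (\<integral>\<omega>. g K (Z \<omega>) \<partial>N) < 1 / 2"
    by (intro order_tendstoD) auto
  then obtain K where K: "(\<integral>\<omega>. g K (Z \<omega>) \<partial>N) < 1 / 2"
    using eventually_happens'[OF sequentially_bot] by blast
  have "bounded (g K ` skorokhod_space)"
    using g01 by (intro boundedI[of _ 1]) fastforce
  then have "(\<lambda>n. \<integral>\<omega>. g K (?Y n \<omega>) \<partial>M) \<longlonglongrightarrow> (\<integral>\<omega>. g K (Z \<omega>) \<partial>N)"
    using conv g[of K] unfolding converges_in_distribution_def topspace_J1_topology by blast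
  then have ev1: "\<forall>\<^sub>F n in sequentially. (\<integral>\<omega>. g K (?Y n \<omega>) \<partial>M) < 1 / 2"
    using K by (rule order_tendstoD)
  \<comment> \<open>The number of steps that fit before time b K: i \<le> r n implies i / n \<le> b
    K. It tends to infinity because K is now fixed.\<close>
  define r where "r n = n div (2 * Suc K)" for n
  have "filterlim r at_top sequentially"
    unfolding filterlim_at_top
  proof
    fix m
    show "\<forall>\<^sub>F n in sequentially. m \<le> r n"
      using eventually_ge_at_top[of "m * (2 * Suc K)"]
      by eventually_elim (simp add: r_def less_eq_div_iff_mult_less_eq)
  qed
  then have "(\<lambda>n. q ^ r n) \<longlonglongrightarrow> 0"
    by (rule filterlim_compose[OF LIMSEQ_realpow_zero[OF q]])
  then have ev2: "\<forall>\<^sub>F n in sequentially. q ^ r n < 1 / 2"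
    by (rule order_tendstoD) simp
  \<comment> \<open>The test function is 1 as soon as one of the first r n steps equals v, which
    fails with probability q ^ r n. For large n both this probability and the integral are below
    1/2, so a n < C becomes impossible.\<close>
  have key: "1 - q ^ r n \<le> (\<integral>\<omega>. g K (?Y n \<omega>) \<partial>M)" if n: "n \<ge> 1" "a n < C" for n
  proof -
    let ?E = "{\<omega> \<in> space M. \<forall>i\<in>{1..r n}. \<xi>s i \<omega> \<in> - {v}}"
    have \<xi>s: "\<xi>s i \<in> M \<rightarrow>\<^sub>M count_space UNIV" if "i \<ge> 1" for i
      using ind that unfolding M.indep_vars_def2 by auto
    have "{\<omega> \<in> space M. \<xi>s i \<omega> \<in> - {v}} \<in> M.events" if "i \<in> {1..r n}" for i
      using measurable_sets[OF \<xi>s, of i "- {v}"] that by (simp add: vimage_def Int_def conj_commute)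
    then have E: "?E \<in> M.events" by (intro sets.sets_Collect_finite_All) auto
    have "P.prob {\<omega> \<in> space P. \<xi> \<omega> \<in> - {v}} = q"
    proof -
      have "{\<omega> \<in> space P. \<xi> \<omega> = v} = \<xi> -` {v} \<inter> space P" by auto
      then have "{\<omega> \<in> space P. \<xi> \<omega> = v} \<in> P.events" using \<xi> by simp
      from P.prob_compl[OF this] show ?thesis
        unfolding q_def by (simp add: set_diff_eq Compl_eq) (metis (mono_tags, lifting) Collect_cong)
    qed
    then have probE: "M.prob ?E = q ^ r n"
      using iid_cylinder[OF M P \<xi> ind eq, of "r n" "\<lambda>_. - {v}"] by simp
    have one: "1 \<le> g K (?Y n \<omega>)" if \<omega>: "\<omega> \<in> space M - ?E" for \<omega>
    proof -
      obtain i where i: "i \<in> {1..r n}" "\<xi>s i \<omega> = v" using \<omega> by auto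
      then obtain j where j: "i = Suc j" by (cases i) auto
      have "i * (2 * Suc K) \<le> n"
        using i(1) by (simp add: r_def less_eq_div_iff_mult_less_eq)
      then have "real (i * (2 * Suc K)) \<le> real n" by (rule of_nat_mono)
      then have ib: "real i / real n \<le> b K"
        using n by (simp add: b_def field_simps)
      have jb: "real j / real n \<le> b K"
        by (rule order_trans[OF _ ib]) (simp add: j divide_right_mono)
      have "dist (?Y n \<omega> (real j / real n)) (?Y n \<omega> (real i / real n)) = norm (vec_of_int v) / a n"
      proof -
        have "random_walk \<xi>s i \<omega> = random_walk \<xi>s j \<omega> + v" using i(2) by (simp add: random_walk_def j)
        then have "dist (?Y n \<omega> (real j / real n)) (?Y n \<omega> (real i / real n)) =
            norm (vec_of_int v /\<^sub>R a n)"
          using n by (simp add: scaled_path_grid vec_of_int_add scaleR_add_right dist_norm)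
        then show ?thesis using a[OF n(1)] by (simp add: divide_inverse mult.commute)
      qed
      moreover have "norm (vec_of_int v) / C \<le> norm (vec_of_int v) / a n"
        using n a[OF n(1)] by (intro divide_left_mono) auto
      moreover have "3 * \<eta> < norm (vec_of_int v) / C"
        using v(1) C by (simp add: \<eta>_def field_simps)
      ultimately have "3 * \<eta> < dist (?Y n \<omega> (real j / real n)) (?Y n \<omega> (real i / real n))"
        by linarith
      then show ?thesis
        unfolding g_def f_def
        by (intro J1_envelope_oscillation[OF scaled_path_in_skorokhod_space \<eta> b, where s = "real j / real n" and t = "real i / real n"])
          (use ib jb in auto)
    qed
    have "1 - q ^ r n = (\<integral>\<omega>. indicator (space M - ?E) \<omega> \<partial>M)"
      using M.prob_compl[OF E] probE E by simp
    also have "\<dots> \<le> (\<integral>\<omega>. g K (?Y n \<omega>) \<partial>M)"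
    proof (rule integral_mono)
      show "integrable M (indicator (space M - ?E) :: _ \<Rightarrow> real)"
        using E by (intro integrable_real_indicator) (auto simp: M.emeasure_eq_measure)
      show "integrable M (\<lambda>\<omega>. g K (?Y n \<omega>))"
        by (rule M.integrable_const_bound[where B = 1])
          (use g01[OF scaled_path_in_skorokhod_space] measurable_compose[OF Y continuous_map_borel_of[OF g]] in auto)
      show "indicator (space M - ?E) \<omega> \<le> g K (?Y n \<omega>)" if "\<omega> \<in> space M" for \<omega>
        using one[of \<omega>] g01[OF scaled_path_in_skorokhod_space, of K] that
        by (auto split: split_indicator)
    qed
    finally show ?thesis .
  qed
  have "\<forall>\<^sub>F n in sequentially. \<not> a n < C"
    using ev1 ev2 eventually_ge_at_top[of 1]
  proof eventually_elim
    case (elim n)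
    then show ?case using key[of n] by linarith
  qed
  then show False using freq unfolding frequently_def by blast
qed

section \<open>Convergence for Lipschitz test functions\<close>

text \<open>A three-term estimate through the shifted chain \<open>y k n\<close>: its distance in
  law from the random walk is controlled by the probability of \<open>Z k\<close> for all n at once,
  and its distance from the full chain vanishes as n grows with k fixed.\<close>

lemma perturbed_walk_Lipschitz_tendsto:
  fixes X :: "nat \<Rightarrow> 'k \<Rightarrow> int ^ 'd" and g :: "(real \<Rightarrow> real ^ 'd) \<Rightarrow> real"
  assumes M: "prob_space M" and P: "prob_space P"
    and \<xi>: "\<xi> \<in> P \<rightarrow>\<^sub>M count_space UNIV"
    and ind: "prob_space.indep_vars M (\<lambda>_. count_space UNIV) \<xi>s {1..}"
    and eq: "\<And>i. i \<ge> 1 \<Longrightarrow> distr M (count_space UNIV) (\<xi>s i) = distr P (count_space UNIV) \<xi>"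
    and mc: "markov_chain M' (perturbed_kernel P \<xi> A \<eta>) X"
    and a: "\<And>n. n \<ge> 1 \<Longrightarrow> a n > 0" and a_top: "filterlim a at_top sequentially"
    and A: "AE \<omega> in M'. finite {n. X n \<omega> \<in> A}"
    and g01: "\<And>x. x \<in> skorokhod_space \<Longrightarrow> g x \<in> {0..1}"
    and Lip: "\<And>x y. x \<in> skorokhod_space \<Longrightarrow> y \<in> skorokhod_space \<Longrightarrow>
      \<bar>g x - g y\<bar> \<le> L * J1_gauge x y"
    and lim: "(\<lambda>n. \<integral>\<omega>. g (scaled_path (\<lambda>k. random_walk \<xi>s k \<omega>) n (a n)) \<partial>M) \<longlonglongrightarrow> l"
  shows "(\<lambda>n. \<integral>\<omega>. g (scaled_path (\<lambda>k. X k \<omega>) n (a n)) \<partial>M') \<longlonglongrightarrow> l"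
proof -
  interpret M: prob_space M by (rule M)
  interpret M': prob_space M' using mc by (simp add: markov_chain_def)
  have X[measurable]: "X i \<in> M' \<rightarrow>\<^sub>M count_space UNIV" for i using mc by (simp add: markov_chain_def)
  have \<xi>s: "\<xi>s i \<in> M \<rightarrow>\<^sub>M count_space UNIV" if "i \<ge> 1" for i
    using ind that unfolding M.indep_vars_def2 by auto
  have g: "continuous_map J1_topology euclideanreal g" by (rule J1_gauge_continuous_map[OF Lip])
  have g01': "g (scaled_path w n c) \<in> {0..1}" for w :: "nat \<Rightarrow> int ^ 'd" and n c
    by (rule g01[OF scaled_path_in_skorokhod_space])
  have mg: "(\<lambda>\<omega>. g (scaled_path (\<lambda>k. V k \<omega>) n c)) \<in> borel_measurable K"
    if "\<And>k. V k \<in> K \<rightarrow>\<^sub>M count_space UNIV" for V :: "nat \<Rightarrow> 'w \<Rightarrow> int ^ 'd" and K n c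
    by (rule measurable_compose[OF scaled_path_measurable[OF that] continuous_map_borel_of[OF g]])
  define Y where "Y n \<omega> = scaled_path (\<lambda>k. random_walk \<xi>s k \<omega>) n (a n)" for n \<omega>
  define x where "x n \<omega> = scaled_path (\<lambda>k. X k \<omega>) n (a n)" for n \<omega>
  define y where "y k n \<omega> = scaled_path (\<lambda>j. X (k + j) \<omega> - X k \<omega>) n (a n)" for k n \<omega>
  define Z where "Z k = {\<omega> \<in> space M'. \<exists>j\<ge>k. X j \<omega> \<in> A}" for k
  have Z: "Z k \<in> M'.events" for k unfolding Z_def by measurable
  have mdiff: "(\<lambda>\<omega>. X (k + j) \<omega> - X k \<omega>) \<in> M' \<rightarrow>\<^sub>M count_space UNIV" for k j
  proof -
    have "(\<lambda>\<omega>. u - X k \<omega>) \<in> M' \<rightarrow>\<^sub>M count_space UNIV" for u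
      by (rule measurable_compose[OF X]) auto
    from measurable_compose_countable[OF this X] show ?thesis by simp
  qed
  have mx: "(\<lambda>\<omega>. g (x n \<omega>)) \<in> borel_measurable M'" for n unfolding x_def by (rule mg[OF X])
  have my: "(\<lambda>\<omega>. g (y k n \<omega>)) \<in> borel_measurable M'" for k n unfolding y_def by (rule mg[OF mdiff])
  have ix: "integrable M' (\<lambda>\<omega>. g (x n \<omega>))" for n
    by (rule M'.integrable_const_bound[where B = 1, OF AE_I2 mx]) (use g01' in \<open>simp add: x_def\<close>)
  have iy: "integrable M' (\<lambda>\<omega>. g (y k n \<omega>))" for k n
    by (rule M'.integrable_const_bound[where B = 1, OF AE_I2 my]) (use g01' in \<open>simp add: y_def\<close>)
  \<comment> \<open>The events decrease to that of infinitely many visits to A, which is null by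
    assumption.\<close>
  have Z0: "(\<lambda>k. M'.prob (Z k)) \<longlonglongrightarrow> 0"
  proof -
    have "(\<lambda>k. M'.prob (Z k)) \<longlonglongrightarrow> M'.prob (\<Inter>k. Z k)"
      using Z by (intro M'.finite_Lim_measure_decseq) (auto simp: decseq_def Z_def intro: order_trans)
    moreover have "M'.prob (\<Inter>k. Z k) = 0"
    proof -
      have "AE \<omega> in M'. \<omega> \<notin> (\<Inter>k. Z k)"
        using A
      proof eventually_elim
        case (elim \<omega>)
        then obtain m where "\<And>n. X n \<omega> \<in> A \<Longrightarrow> n < m"
          using finite_nat_set_iff_bounded[of "{n. X n \<omega> \<in> A}"] by auto
        then have "\<omega> \<notin> Z m" by (auto simp: Z_def not_less[symmetric])
        then show ?case by blast
      qed
      moreover have "(\<Inter>k. Z k) \<in> M'.events" using Z by auto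
      ultimately show ?thesis using M'.prob_eq_0 by blast
    qed
    ultimately show ?thesis by simp
  qed
  have compare: "\<bar>(\<integral>\<omega>. g (y k n \<omega>) \<partial>M') - (\<integral>\<omega>. g (Y n \<omega>) \<partial>M)\<bar> \<le> M'.prob (Z k)" for k n
  proof -
    define \<Psi> where "\<Psi> z = g (scaled_path (\<lambda>j. \<Sum>i=1..j. z i) n (a n))" for z
    have \<Psi>01: "\<Psi> z \<in> {0..1}" for z unfolding \<Psi>_def by (rule g01')
    have \<Psi>lim: "(\<lambda>m. \<Psi> (\<lambda>i. if i \<in> {1..m} then z i else 0)) \<longlonglongrightarrow> \<Psi> z" for z
      unfolding \<Psi>_def by (rule scaled_path_truncation_tendsto[OF g])
    have sum: "(\<Sum>i=1..j. X (k + i) \<omega> - X (k + i - 1) \<omega>) = X (k + j) \<omega> - X k \<omega>" for j \<omega>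
      by (induction j) auto
    have \<Psi>y: "\<Psi> (\<lambda>i. X (k + i) \<omega> - X (k + i - 1) \<omega>) = g (y k n \<omega>)" for \<omega>
      unfolding \<Psi>_def y_def sum ..
    have \<Psi>Y: "\<Psi> (\<lambda>i. \<xi>s i \<omega>) = g (Y n \<omega>)" for \<omega>
      unfolding \<Psi>_def Y_def random_walk_def ..
    have mrw: "random_walk \<xi>s j \<in> M \<rightarrow>\<^sub>M count_space UNIV" for j
    proof (induction j)
      case (Suc j)
      have "(\<lambda>\<omega>. u + \<xi>s (Suc j) \<omega>) \<in> M \<rightarrow>\<^sub>M count_space UNIV" for u
        by (rule measurable_compose[OF \<xi>s]) auto
      from measurable_compose_countable[OF this Suc] show ?case
        by (simp add: random_walk_def[abs_def])
    qed (simp add: random_walk_def[abs_def])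
    have iY: "integrable M (\<lambda>\<omega>. g (Y n \<omega>))"
      unfolding Y_def
      by (rule M.integrable_const_bound[where B = 1, OF AE_I2 mg[OF mrw]]) (use g01' in simp)
    have up: "(\<integral>\<omega>. g (y k n \<omega>) \<partial>M') \<le> (\<integral>\<omega>. g (Y n \<omega>) \<partial>M) + M'.prob (Z k)"
      using perturbed_walk_compare[OF M P \<xi> ind eq mc \<Psi>01 \<Psi>lim, of k]
      unfolding \<Psi>y \<Psi>Y Z_def .
    \<comment> \<open>The comparison is one-sided; applied to 1 - \<Psi> it gives the missing lower
      bound with the same error.\<close>
    have \<Psi>01': "1 - \<Psi> z \<in> {0..1}" for z using \<Psi>01[of z] by simp
    have \<Psi>lim': "(\<lambda>m. 1 - \<Psi> (\<lambda>i. if i \<in> {1..m} then z i else 0)) \<longlonglongrightarrow> 1 - \<Psi> z" for z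
      by (intro tendsto_diff tendsto_const \<Psi>lim)
    have "(\<integral>\<omega>. 1 - g (y k n \<omega>) \<partial>M') \<le> (\<integral>\<omega>. 1 - g (Y n \<omega>) \<partial>M) + M'.prob (Z k)"
      using perturbed_walk_compare[OF M P \<xi> ind eq mc \<Psi>01' \<Psi>lim', of k]
      unfolding \<Psi>y \<Psi>Y Z_def .
    also have "(\<integral>\<omega>. 1 - g (y k n \<omega>) \<partial>M') = 1 - (\<integral>\<omega>. g (y k n \<omega>) \<partial>M')"
      using iy by (simp add: M'.prob_space)
    also have "(\<integral>\<omega>. 1 - g (Y n \<omega>) \<partial>M) = 1 - (\<integral>\<omega>. g (Y n \<omega>) \<partial>M)"
      using iY by (simp add: M.prob_space)
    finally show ?thesis using up by linarith
  qed
  have close: "(\<lambda>n. \<integral>\<omega>. g (y k n \<omega>) - g (x n \<omega>) \<partial>M') \<longlonglongrightarrow> 0" for k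
  proof -
    have "(\<lambda>n. g (y k n \<omega>) - g (x n \<omega>)) \<longlonglongrightarrow> 0" for \<omega>
    proof -
      \<comment> \<open>This bound depends on \<omega>, so the difference tends to 0 only pointwise;
        dominated convergence then passes to the integrals.\<close>
      define B where "B = (\<Sum>j\<le>k. norm (vec_of_int (X j \<omega>)))"
      \<comment> \<open>The last summand makes both inequalities required by the shift estimate
        strict.\<close>
      define \<epsilon> where "\<epsilon> n = real k * inverse (real n) + B * inverse (a n) + inverse (real n)" for n
      have inv: "(\<lambda>n. inverse (real n)) \<longlonglongrightarrow> 0" by (rule lim_inverse_n)
      have "(\<lambda>n. inverse (a n)) \<longlonglongrightarrow> 0"
        by (rule tendsto_inverse_0_at_top[OF a_top])
      then have "\<epsilon> \<longlonglongrightarrow> real k * 0 + B * 0 + 0"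
        unfolding \<epsilon>_def by (intro tendsto_intros inv)
      then have "(\<lambda>n. \<bar>L\<bar> * \<epsilon> n) \<longlonglongrightarrow> 0"
        using tendsto_mult_right_zero[of \<epsilon> sequentially "\<bar>L\<bar>"] by simp
      moreover have "\<forall>\<^sub>F n in sequentially. norm (g (y k n \<omega>) - g (x n \<omega>)) \<le> \<bar>L\<bar> * \<epsilon> n"
        using eventually_ge_at_top[of 1]
      proof eventually_elim
        case (elim n)
        have B: "norm (vec_of_int (X j \<omega>)) \<le> B" if "j \<le> k" for j
          unfolding B_def by (rule member_le_sum) (use that in auto)
        have "0 \<le> B" by (simp add: B_def sum_nonneg)
        then have pos: "0 \<le> B * inverse (a n)" "0 < inverse (real n)" "0 \<le> real k * inverse (real n)"
          using a[OF elim] elim by auto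
        then have eps: "real k / real n < \<epsilon> n" "B / a n < \<epsilon> n"
          unfolding \<epsilon>_def divide_inverse by linarith+
        have "J1_gauge (y k n \<omega>) (x n \<omega>) \<le> \<epsilon> n"
          unfolding y_def x_def
          by (rule J1_gauge_scaled_path_shift[OF _ a[OF elim] B eps]) (use elim in auto)
        then have "\<bar>L\<bar> * J1_gauge (y k n \<omega>) (x n \<omega>) \<le> \<bar>L\<bar> * \<epsilon> n" by (intro mult_left_mono) auto
        moreover have "L * J1_gauge (y k n \<omega>) (x n \<omega>) \<le> \<bar>L\<bar> * J1_gauge (y k n \<omega>) (x n \<omega>)"
          by (intro mult_right_mono J1_gauge_nonneg) auto
        moreover have "\<bar>g (y k n \<omega>) - g (x n \<omega>)\<bar> \<le> L * J1_gauge (y k n \<omega>) (x n \<omega>)"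
          unfolding y_def x_def by (rule Lip[OF scaled_path_in_skorokhod_space scaled_path_in_skorokhod_space])
        ultimately show ?case by simp
      qed
      ultimately show ?thesis by (rule Lim_null_comparison[rotated])
    qed
    then have "(\<lambda>n. \<integral>\<omega>. g (y k n \<omega>) - g (x n \<omega>) \<partial>M') \<longlonglongrightarrow> (\<integral>\<omega>. 0 \<partial>M')"
    proof (intro integral_dominated_convergence[where w = "\<lambda>_. 1"] AE_I2)
      show "norm (g (y k n \<omega>) - g (x n \<omega>)) \<le> 1" for n \<omega>
        using g01'[of "\<lambda>j. X (k + j) \<omega> - X k \<omega>" n "a n"] g01'[of "\<lambda>k. X k \<omega>" n "a n"]
        unfolding x_def y_def by auto
    qed (use mx my in auto)
    then show ?thesis by simp
  qed
  show ?thesis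
  proof (rule LIMSEQ_I)
    fix e :: real assume e: "e > 0"
    then have "\<forall>\<^sub>F k in sequentially. M'.prob (Z k) < e / 3"
      using Z0 by (intro order_tendstoD(2)) auto
    then obtain k where k: "M'.prob (Z k) < e / 3"
      using eventually_happens'[OF sequentially_bot] by blast
    have "\<forall>\<^sub>F n in sequentially. dist (\<integral>\<omega>. g (y k n \<omega>) - g (x n \<omega>) \<partial>M') 0 < e / 3"
      using e by (intro tendstoD[OF close]) auto
    moreover have "\<forall>\<^sub>F n in sequentially. dist (\<integral>\<omega>. g (Y n \<omega>) \<partial>M) l < e / 3"
      using e lim unfolding Y_def by (intro tendstoD) auto
    ultimately have "\<forall>\<^sub>F n in sequentially. norm ((\<integral>\<omega>. g (x n \<omega>) \<partial>M') - l) < e"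
    proof eventually_elim
      case (elim n)
      have "(\<integral>\<omega>. g (y k n \<omega>) - g (x n \<omega>) \<partial>M') = (\<integral>\<omega>. g (y k n \<omega>) \<partial>M') - (\<integral>\<omega>. g (x n \<omega>) \<partial>M')"
        using ix iy by simp
      then show ?case
        using elim compare[of k n] k unfolding dist_real_def real_norm_def by linarith
    qed
    then show "\<exists>n0. \<forall>n\<ge>n0. norm ((\<integral>\<omega>. g (scaled_path (\<lambda>k. X k \<omega>) n (a n)) \<partial>M') - l) < e"
      unfolding x_def by (simp add: eventually_sequentially)
  qed
qed

theorem proposition2p1:
  fixes P :: "'p measure" and M :: "'m measure" and M' :: "'k measure" and N :: "'v measure"
    and \<xi> :: "'p \<Rightarrow> int ^ 'd"
    and A :: "(int ^ 'd) set" and \<eta> :: "int ^ 'd \<Rightarrow> 'p \<Rightarrow> int ^ 'd"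
    and \<xi>s :: "nat \<Rightarrow> 'm \<Rightarrow> int ^ 'd"
    and X :: "nat \<Rightarrow> 'k \<Rightarrow> int ^ 'd"
    and a :: "nat \<Rightarrow> real" and S :: "real \<Rightarrow> 'v \<Rightarrow> real ^ 'd"
  assumes "prob_space P"
    and "\<xi> \<in> P \<rightarrow>\<^sub>M count_space UNIV"
    and "finite A"
    and "\<And>x. x \<in> A \<Longrightarrow> \<eta> x \<in> P \<rightarrow>\<^sub>M count_space UNIV"
    \<comment> \<open>\<open>\<xi>s 1, \<xi>s 2, \<dots>\<close> are independent copies of \<open>\<xi>\<close>\<close>
    and "prob_space M"
    and "prob_space.indep_vars M (\<lambda>_. count_space UNIV) \<xi>s {1..}"
    and "\<And>i. i \<ge> 1 \<Longrightarrow> distr M (count_space UNIV) (\<xi>s i) = distr P (count_space UNIV) \<xi>"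
    and "markov_chain M' (perturbed_kernel P \<xi> A \<eta>) X"
    and "\<And>n. n \<ge> 1 \<Longrightarrow> a n > 0"
    \<comment> \<open>void unless \<open>\<xi>\<close> vanishes almost surely; without it the claim fails for \<open>\<xi> = 0\<close>, \<open>a n = 1\<close>,
        \<open>A = {}\<close>, \<open>X n = x \<noteq> 0\<close>\<close>
    and "(AE \<omega> in P. \<xi> \<omega> = 0) \<longrightarrow> filterlim a at_top sequentially"
    and "converges_in_distribution J1_topology
           (\<lambda>_. M) (\<lambda>n \<omega>. scaled_path (\<lambda>k. random_walk \<xi>s k \<omega>) n (a n))
           N (\<lambda>\<omega>. \<lambda>t\<in>{0..}. S t \<omega>)"
    and "AE \<omega> in M'. finite {n. X n \<omega> \<in> A}"
  shows "converges_in_distribution J1_topology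
           (\<lambda>_. M') (\<lambda>n \<omega>. scaled_path (\<lambda>k. X k \<omega>) n (a n))
           N (\<lambda>\<omega>. \<lambda>t\<in>{0..}. S t \<omega>)"
proof -
  note conv = assms(11)
  have M': "prob_space M'" using assms(8) by (simp add: markov_chain_def)
  have X: "X k \<in> M' \<rightarrow>\<^sub>M count_space UNIV" for k using assms(8) by (simp add: markov_chain_def)
  \<comment> \<open>If \<xi> is not almost surely 0, the divergence follows from the convergence of
    the random walk; in the remaining case it is a hypothesis.\<close>
  have top: "filterlim a at_top sequentially"
    using norming_sequence_at_top[OF assms(5,1,2,6,7,9) _ conv] assms(10) by blast
  show ?thesis
  proof (rule J1_converges_in_distributionI)
    show "prob_space N" "(\<lambda>\<omega>. \<lambda>t\<in>{0..}. S t \<omega>) \<in> N \<rightarrow>\<^sub>M borel_of J1_topology"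
      using conv unfolding converges_in_distribution_def by blast+
  next
    fix g :: "(real \<Rightarrow> real ^ 'd) \<Rightarrow> real" and L
    assume g01: "\<And>x. x \<in> skorokhod_space \<Longrightarrow> g x \<in> {0..1}"
      and Lip: "\<And>x y. x \<in> skorokhod_space \<Longrightarrow> y \<in> skorokhod_space \<Longrightarrow>
        \<bar>g x - g y\<bar> \<le> L * J1_gauge x y"
    have "bounded (g ` skorokhod_space)"
      using g01 by (intro boundedI[of _ 1]) fastforce
    then have lim: "(\<lambda>n. \<integral>\<omega>. g (scaled_path (\<lambda>k. random_walk \<xi>s k \<omega>) n (a n)) \<partial>M)
        \<longlonglongrightarrow> (\<integral>\<omega>. g (\<lambda>t\<in>{0..}. S t \<omega>) \<partial>N)"
      using conv J1_gauge_continuous_map[OF Lip]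
      unfolding converges_in_distribution_def topspace_J1_topology by blast
    show "(\<lambda>n. \<integral>\<omega>. g (scaled_path (\<lambda>k. X k \<omega>) n (a n)) \<partial>M')
        \<longlonglongrightarrow> (\<integral>\<omega>. g (\<lambda>t\<in>{0..}. S t \<omega>) \<partial>N)"
      by (rule perturbed_walk_Lipschitz_tendsto[OF assms(5,1,2,6,7,8,9) top assms(12) g01 Lip lim])
  qed (rule M', rule scaled_path_measurable[OF X])
qed

end
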